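(* Let $N\ge 1$, $\alpha\ge 0$, and let $g$ be a locally square-integrable function on $\mathbb{R}^N$. Then $g\in\Lambda_{\alpha}$ if, and only if, $g\in\Lambda_{\alpha,\mathcal{D}}$ and $$A_{\alpha}(g)=\sup_{p\in\mathcal{S}_{\alpha}}\big|\langle g,p\rangle\big|<\infty .$$ Moreover, $$\|g\|_{\Lambda_{\alpha}}\sim\|g\|_{\Lambda_{\alpha,\mathcal{D}}}+A_{\alpha}(g).$$
   Context: Notation. $[\alpha]$ is the integer part of $\alpha$; $\mathcal{P}_d$ is the collection of polynomials in $\mathbb{R}^N$ of degree less than or equal to $d$; $\langle g,p\rangle=\int_{\mathbb{R}^N} g(x)\,p(x)\,dx$; $\chi_Q$ is the characteristic function of $Q$; $|Q|$ is Lebesgue measure. Cubes have sides parallel to the coordinate axes. A function $h$ has vanishing moments up to order $m$ if $\int h(x)\,x^{\beta}\,dx=0$ for all multi-indices $\beta$ with $|\beta|\le m$. The relation $X\sim Y$ means that $c^{-1}X\le Y\le cX$ with a constant $c>0$ depending only on $\alpha$ and $N$ (and on the fixed basis $p^1,\dots,p^M$ below), not on $g$. Lipschitz spaces. For $\alpha\ge0$, a cube $Q$ and a locally integrable function $g$, $p_Q(g)$ denotes the unique polynomial in $\mathcal{P}_{[\alpha]}$ such that $[g-p_Q(g)]\chi_Q$ has vanishing moments up to order $[\alpha]$. For a family $\mathcal{J}$ of cubes in $\mathbb{R}^N$ and a locally square-integrable $g$, let $$M^{\sharp,2}_{\alpha,\mathcal{J}}g(x)=\sup_{x\in Q,\,Q\in\mathcal{J}}\frac{1}{|Q|^{\alpha/N}}\left(\frac1{|Q|}\int_Q|g(y)-p_Q(g)(y)|^2\,dy\right)^{1/2}.$$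 The space $\Lambda_{\alpha,\mathcal{J}}$ consists of those $g$ with $M^{\sharp,2}_{\alpha,\mathcal{J}}g\in L^\infty$, and $\|g\|_{\Lambda_{\alpha,\mathcal{J}}}=\|M^{\sharp,2}_{\alpha,\mathcal{J}}g\|_\infty$. When $\mathcal{J}$ is the family of all cubes in $\mathbb{R}^N$, one writes $\Lambda_\alpha$ (so $\Lambda_0=\mathrm{BMO}$). Dyadic cubes. $\mathcal{D}$ is the collection of all cubes $I_{n,k_1}\times\cdots\times I_{n,k_N}$, where $I_{n,k}=[(k-1)2^n,k2^n]$ and $n,k_1,\dots,k_N$ are arbitrary integers. The family $\mathcal{S}_\alpha$. Let $Q_0=[-1,1]^N$; its $2^N$ dyadic subcubes are the products $J_1\times\cdots\times J_N$ with each $J_j$ equal to $[-1,0]$ or $[0,1]$. Let $A$ be the finite-dimensional subspace of $L^2(Q_0)$ of all functions with vanishing moments up to order $[\alpha]$ that coincide with a polynomial in $\mathcal{P}_{[\alpha]}$ on each of the $2^N$ dyadic subcubes of $Q_0$. Fix an orthonormal basis $p^1,\dots,p^M$ of $A$ in $L^2(Q_0)$, extended by $0$ outside $Q_0$. For $n\in\mathbb{Z}$, $k=(k_1,\dots,k_N)\in\mathbb{Z}^N$ and $1\le L\le M$ put $$p^L_{n,k,\alpha}(x)=2^{n(N+\alpha)}\,p^L(2^nx_1+k_1,\dots,2^nx_N+k_N),$$ and $\mathcal{S}_\alpha=\{p^L_{n,k,\alpha}: n\in\mathbb{Z},\ k\in\mathbb{Z}^N,\ 1\le L\le M\}$. 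*)

theory Defs
  imports "HOL-Analysis.Analysis" "HOL-Probability.Essential_Supremum"
begin

definition mi_monom :: "('n::finite \<Rightarrow> nat) \<Rightarrow> real ^ 'n \<Rightarrow> real"
  where "mi_monom \<beta> x = (\<Prod>i\<in>UNIV. (x $ i) ^ \<beta> i)"

definition multi_indices :: "nat \<Rightarrow> ('n::finite \<Rightarrow> nat) set"
  where "multi_indices d = {\<beta>. (\<Sum>i\<in>UNIV. \<beta> i) \<le> d}"

definition polys :: "nat \<Rightarrow> (real ^ 'n::finite \<Rightarrow> real) set"
  where "polys d = {q. \<exists>c. q = (\<lambda>x. \<Sum>\<beta>\<in>multi_indices d. c \<beta> * mi_monom \<beta> x)}"

definition vanishing_moments :: "nat \<Rightarrow> (real ^ 'n::finite \<Rightarrow> real) \<Rightarrow> bool"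
  where "vanishing_moments m h \<longleftrightarrow>
    (\<forall>\<beta>\<in>multi_indices m. has_bochner_integral lebesgue (\<lambda>x. h x * mi_monom \<beta> x) 0)"

definition intpart :: "real \<Rightarrow> nat"
  where "intpart \<alpha> = nat \<lfloor>\<alpha>\<rfloor>"

definition locally_square_integrable :: "(real ^ 'n::finite \<Rightarrow> real) \<Rightarrow> bool"
  where "locally_square_integrable g \<longleftrightarrow>
    g \<in> borel_measurable lebesgue \<and>
    (\<forall>K. compact K \<longrightarrow> set_integrable lebesgue K (\<lambda>x. (g x)\<^sup>2))"

definition cubes :: "(real ^ 'n::finite) set set"
  where "cubes = {cbox a (\<chi> i. a $ i + s) | a s. s > 0}"

definition dyadic_cubes :: "(real ^ 'n::finite) set set"
  where "dyadic_cubes =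
    {cbox (\<chi> i. (of_int (k i) - 1) * 2 powi n) (\<chi> i. of_int (k i) * 2 powi n) | n (k :: 'n \<Rightarrow> int). True}"

definition proj_poly :: "real \<Rightarrow> (real ^ 'n::finite) set \<Rightarrow> (real ^ 'n \<Rightarrow> real) \<Rightarrow> real ^ 'n \<Rightarrow> real"
  where "proj_poly \<alpha> Q g = (THE q. q \<in> polys (intpart \<alpha>) \<and>
    vanishing_moments (intpart \<alpha>) (\<lambda>x. (g x - q x) * indicator Q x))"

definition sharp_max ::
    "real \<Rightarrow> (real ^ 'n::finite) set set \<Rightarrow> (real ^ 'n \<Rightarrow> real) \<Rightarrow> real ^ 'n \<Rightarrow> ennreal"
  where "sharp_max \<alpha> J g x = (SUP Q\<in>{Q\<in>J. x \<in> Q}. ennreal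
    (1 / (measure lebesgue Q powr (\<alpha> / real CARD('n))) *
     sqrt (1 / measure lebesgue Q * (LINT y:Q|lebesgue. (g y - proj_poly \<alpha> Q g y)\<^sup>2))))"

text \<open>By the library's convention, \<^const>\<open>esssup\<close> is \<open>\<infinity>\<close> on non-measurable functions.\<close>

definition lip_norm :: "real \<Rightarrow> (real ^ 'n::finite) set set \<Rightarrow> (real ^ 'n \<Rightarrow> real) \<Rightarrow> ennreal"
  where "lip_norm \<alpha> J g = esssup lebesgue (sharp_max \<alpha> J g)"

definition lip_space :: "real \<Rightarrow> (real ^ 'n::finite) set set \<Rightarrow> (real ^ 'n \<Rightarrow> real) set"
  where "lip_space \<alpha> J = {g. locally_square_integrable g \<and>
    sharp_max \<alpha> J g \<in> borel_measurable lebesgue \<and> lip_norm \<alpha> J g < \<infinity>}"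

definition Q0 :: "(real ^ 'n::finite) set"
  where "Q0 = cbox (\<chi> i. -1) (\<chi> i. 1)"

definition Q0_subcubes :: "(real ^ 'n::finite) set set"
  where "Q0_subcubes = {cbox a (\<chi> i. a $ i + 1) | a. \<forall>i. a $ i \<in> {-1, 0}}"

text \<open>
  Elements of \<open>L\<^sup>2(Q\<^sub>0)\<close> are represented by functions that are extended by 0 outside \<open>Q\<^sub>0\<close>.
  The closed subcubes overlap in null sets, so agreement with a polynomial on each of them
  has to be understood almost everywhere; it makes the function measurable and bounded almost
  everywhere, hence square-integrable.
\<close>

definition A_space :: "real \<Rightarrow> (real ^ 'n::finite \<Rightarrow> real) set"
  where "A_space \<alpha> = {f. (\<forall>x. x \<notin> Q0 \<longrightarrow> f x = 0) \<and>
    vanishing_moments (intpart \<alpha>) f \<and>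
    (\<forall>J\<in>Q0_subcubes. \<exists>q\<in>polys (intpart \<alpha>). AE x in lebesgue. x \<in> J \<longrightarrow> f x = q x)}"

definition orthonormal_basis_A :: "real \<Rightarrow> nat \<Rightarrow> (nat \<Rightarrow> real ^ 'n::finite \<Rightarrow> real) \<Rightarrow> bool"
  where "orthonormal_basis_A \<alpha> M p \<longleftrightarrow>
    (\<forall>L\<in>{1..M}. p L \<in> A_space \<alpha>) \<and>
    (\<forall>L\<in>{1..M}. \<forall>L'\<in>{1..M}.
      (LINT x:Q0|lebesgue. p L x * p L' x) = (if L = L' then 1 else 0)) \<and>
    (\<forall>f\<in>A_space \<alpha>. \<exists>c. AE x in lebesgue. f x = (\<Sum>L\<in>{1..M}. c L * p L x))"

definition S_family ::
    "real \<Rightarrow> nat \<Rightarrow> (nat \<Rightarrow> real ^ 'n::finite \<Rightarrow> real) \<Rightarrow> (real ^ 'n \<Rightarrow> real) set"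
  where "S_family \<alpha> M p =
    {(\<lambda>x. 2 powr (of_int n * (real CARD('n) + \<alpha>)) * p L (\<chi> i. 2 powi n * x $ i + of_int (k i)))
      | n (k :: 'n \<Rightarrow> int) L. L \<in> {1..M}}"

definition pairing :: "(real ^ 'n::finite \<Rightarrow> real) \<Rightarrow> (real ^ 'n \<Rightarrow> real) \<Rightarrow> real"
  where "pairing g h = (LINT x|lebesgue. g x * h x)"

definition A_functional ::
    "real \<Rightarrow> nat \<Rightarrow> (nat \<Rightarrow> real ^ 'n::finite \<Rightarrow> real) \<Rightarrow> (real ^ 'n \<Rightarrow> real) \<Rightarrow> ennreal"
  where "A_functional \<alpha> M p g = (SUP h\<in>S_family \<alpha> M p. ennreal \<bar>pairing g h\<bar>)"

end

theory Submission
  imports Defs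
begin

text \<open>
  All estimates are made in \<open>L\<^sup>2\<close>. On a cube \<open>Q\<close> the polynomial \<open>p\<^sub>Q(g)\<close> is the orthogonal projection
  of \<open>g\<close> onto polynomials of degree at most \<open>[\<alpha>]\<close>, hence the best approximation, and the square
  error \<open>poly_error\<close> is monotone in \<open>Q\<close> (\<open>poly_error_mono\<close>). Both seminorms are then plain suprema of
  normalised errors, the oscillations, over the cubes concerned
  (\<open>lip_norm_eq_SUP_oscillation\<close>).

  Clearly the dyadic seminorm is at most the full one. A member of \<open>\<S>\<^sub>\<alpha>\<close> has vanishing moments and
  lives on a cube \<open>R\<close> which is a dyadic rescaling of \<open>[-1,1]\<^sup>N\<close>; its pairing with \<open>g\<close> equals that with
  \<open>g - p\<^sub>R(g)\<close>, and Cauchy--Schwarz bounds it by the oscillation of \<open>R\<close> (\<open>A_functional_le\<close>).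

  For the converse, every cube lies in such a cube \<open>R\<close> of comparable side
  (\<open>cube_subset_dyadic_double_cube\<close>), so only these have to be treated, and by homogeneity
  (\<open>oscillation_affine\<close>, \<open>pairing_S_family\<close>) it suffices to consider \<open>R = [-1,1]\<^sup>N\<close>. There the
  dyadic seminorm controls the distance of \<open>g\<close> from the piecewise polynomial \<open>F\<close> assembled from the
  projections on the \<open>2\<^sup>N\<close> subcubes, but says nothing about how these pieces fit together. That
  information is \<open>F - p\<^sub>R(g)\<close>, an element of the finite-dimensional space \<open>A\<close>, whose coefficients in
  the orthonormal basis are exactly the pairings of \<open>g\<close> with \<open>p\<^sup>1, \<dots>, p\<^sup>M\<close>
  (\<open>poly_error_Q0_le\<close>).
\<close>

section \<open>Polynomials in several variables\<close>

lemma finite_multi_indices: "finite (multi_indices d :: ('n::finite \<Rightarrow> nat) set)"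
proof (rule finite_subset)
  have "\<beta> i \<le> d" if "(\<Sum>i\<in>UNIV. \<beta> i) \<le> d" for \<beta> :: "'n \<Rightarrow> nat" and i
    using member_le_sum[of i UNIV \<beta>] that by simp
  then show "multi_indices d \<subseteq> {\<beta> :: 'n \<Rightarrow> nat. \<forall>i. (i \<in> UNIV \<longrightarrow> \<beta> i \<in> {..d}) \<and> (i \<notin> UNIV \<longrightarrow> \<beta> i = 0)}"
    by (auto simp: multi_indices_def)
  show "finite \<dots>"
    by (rule finite_set_of_finite_funs) auto
qed

lemma polysE:
  assumes "q \<in> polys d"
  obtains c where "q = (\<lambda>x. \<Sum>\<beta>\<in>multi_indices d. c \<beta> * mi_monom \<beta> x)"
  using assms by (auto simp: polys_def)

lemma polysI: "q = (\<lambda>x. \<Sum>\<beta>\<in>multi_indices d. c \<beta> * mi_monom \<beta> x) \<Longrightarrow> q \<in> polys d"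
  by (auto simp: polys_def)

lemma mi_monom_in_polys:
  assumes "\<beta> \<in> multi_indices d"
  shows "mi_monom \<beta> \<in> polys d"
proof -
  have "mi_monom \<beta> = (\<lambda>x. \<Sum>\<gamma>\<in>multi_indices d. (if \<gamma> = \<beta> then 1 else 0) * mi_monom \<gamma> x)"
  proof
    fix x
    have "(\<Sum>\<gamma>\<in>multi_indices d. (if \<gamma> = \<beta> then 1 else 0) * mi_monom \<gamma> x) =
        (\<Sum>\<gamma>\<in>multi_indices d. if \<gamma> = \<beta> then mi_monom \<gamma> x else 0)"
      by (intro sum.cong) auto
    then show "mi_monom \<beta> x = (\<Sum>\<gamma>\<in>multi_indices d. (if \<gamma> = \<beta> then 1 else 0) * mi_monom \<gamma> x)"
      using assms by (simp add: finite_multi_indices)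
  qed
  then show ?thesis by (rule polysI)
qed

lemma polys_add:
  assumes "q \<in> polys d" "r \<in> polys d"
  shows "(\<lambda>x. q x + r x) \<in> polys d"
proof -
  obtain c where q: "q = (\<lambda>x. \<Sum>\<beta>\<in>multi_indices d. c \<beta> * mi_monom \<beta> x)"
    using assms(1) by (rule polysE)
  obtain e where r: "r = (\<lambda>x. \<Sum>\<beta>\<in>multi_indices d. e \<beta> * mi_monom \<beta> x)"
    using assms(2) by (rule polysE)
  have "(\<lambda>x. q x + r x) = (\<lambda>x. \<Sum>\<beta>\<in>multi_indices d. (c \<beta> + e \<beta>) * mi_monom \<beta> x)"
    by (simp add: q r sum.distrib algebra_simps)
  then show ?thesis by (rule polysI)
qed

lemma polys_cmult:
  assumes "q \<in> polys d"
  shows "(\<lambda>x. a * q x) \<in> polys d"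
proof -
  obtain c where "q = (\<lambda>x. \<Sum>\<beta>\<in>multi_indices d. c \<beta> * mi_monom \<beta> x)"
    using assms by (rule polysE)
  then have "(\<lambda>x. a * q x) = (\<lambda>x. \<Sum>\<beta>\<in>multi_indices d. (a * c \<beta>) * mi_monom \<beta> x)"
    by (simp add: sum_distrib_left mult.assoc)
  then show ?thesis by (rule polysI)
qed

lemma polys_diff:
  assumes "q \<in> polys d" "r \<in> polys d"
  shows "(\<lambda>x. q x - r x) \<in> polys d"
  using polys_add[OF assms(1) polys_cmult[OF assms(2), of "-1"]] by simp

lemma polys_zero: "(\<lambda>x. 0) \<in> polys d"
  by (rule polysI[of _ "\<lambda>_. 0"]) simp

lemma polys_sum:
  assumes "\<And>i. i \<in> I \<Longrightarrow> f i \<in> polys d"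
  shows "(\<lambda>x. \<Sum>i\<in>I. f i x) \<in> polys d"
  using assms by (induction I rule: infinite_finite_induct) (auto intro: polys_add polys_zero)

lemma polys_mono: "d \<le> e \<Longrightarrow> q \<in> polys d \<Longrightarrow> q \<in> polys e"
  by (erule polysE)
    (auto intro!: polys_sum polys_cmult mi_monom_in_polys simp: multi_indices_def)

lemma polys_mult:
  assumes "q \<in> polys d" "r \<in> polys e"
  shows "(\<lambda>x. q x * r x) \<in> polys (d + e)"
proof -
  obtain c where q: "q = (\<lambda>x. \<Sum>\<beta>\<in>multi_indices d. c \<beta> * mi_monom \<beta> x)"
    using assms(1) by (rule polysE)
  obtain b where r: "r = (\<lambda>x. \<Sum>\<gamma>\<in>multi_indices e. b \<gamma> * mi_monom \<gamma> x)"
    using assms(2) by (rule polysE)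
  have monom_mult: "mi_monom \<beta> x * mi_monom \<gamma> x = mi_monom (\<lambda>i. \<beta> i + \<gamma> i) x" for \<beta> \<gamma> :: "'a \<Rightarrow> nat" and x
    by (simp add: mi_monom_def power_add prod.distrib)
  have eq: "(\<lambda>x. q x * r x) =
     (\<lambda>x. \<Sum>\<beta>\<in>multi_indices d. \<Sum>\<gamma>\<in>multi_indices e. (c \<beta> * b \<gamma>) * mi_monom (\<lambda>i. \<beta> i + \<gamma> i) x)"
    unfolding q r sum_product by (simp add: monom_mult[symmetric] mult.assoc mult.left_commute)
  show ?thesis unfolding eq
    by (intro polys_sum polys_cmult mi_monom_in_polys)
      (auto simp: multi_indices_def sum.distrib intro: add_mono)
qed

lemma polys_const: "(\<lambda>x. a) \<in> polys d"
proof -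
  have "mi_monom (\<lambda>_. 0) \<in> polys d" by (rule mi_monom_in_polys) (simp add: multi_indices_def)
  from polys_cmult[OF this, of a] show ?thesis by (simp add: mi_monom_def)
qed

lemma polys_coord: "(\<lambda>x. x $ i) \<in> polys 1"
proof -
  define \<beta> where "\<beta> = (\<lambda>j. if j = i then 1 else 0 :: nat)"
  have "mi_monom \<beta> \<in> polys 1" by (rule mi_monom_in_polys) (simp add: multi_indices_def \<beta>_def)
  moreover have "mi_monom \<beta> = (\<lambda>x. x $ i)"
    by (auto simp: mi_monom_def \<beta>_def if_distrib[of "power _"] cong: if_cong)
  ultimately show ?thesis by simp
qed

lemma polys_power:
  assumes "q \<in> polys d"
  shows "(\<lambda>x. q x ^ k) \<in> polys (k * d)"
  by (induction k) (use polys_const polys_mult[OF assms] in auto)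

lemma polys_prod:
  assumes "finite I" "\<And>i. i \<in> I \<Longrightarrow> f i \<in> polys (d i)"
  shows "(\<lambda>x. \<Prod>i\<in>I. f i x) \<in> polys (\<Sum>i\<in>I. d i)"
  using assms by (induction I) (auto intro: polys_const polys_mult)

text \<open>A monomial composed with the affine map is a product of powers of polynomials of degree 1, so
  its degree is bounded without any binomial expansion.\<close>

lemma polys_affine:
  assumes "q \<in> polys d"
  shows "(\<lambda>x. q (t + r *\<^sub>R x)) \<in> polys d"
proof -
  obtain c where q: "q = (\<lambda>x. \<Sum>\<beta>\<in>multi_indices d. c \<beta> * mi_monom \<beta> x)"
    using assms by (rule polysE)
  have "(\<lambda>x. mi_monom \<beta> (t + r *\<^sub>R x)) \<in> polys d" if "\<beta> \<in> multi_indices d" for \<beta>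
  proof -
    have coord: "(\<lambda>x. t $ i + r * x $ i) \<in> polys 1" for i
      by (intro polys_add polys_const polys_cmult polys_coord)
    have "(\<lambda>x. \<Prod>i\<in>UNIV. (t $ i + r * x $ i) ^ \<beta> i) \<in> polys (\<Sum>i\<in>UNIV. \<beta> i * 1)"
      by (intro polys_prod polys_power coord) simp
    then show ?thesis
      using that by (auto simp: mi_monom_def multi_indices_def intro: polys_mono)
  qed
  then show ?thesis unfolding q by (intro polys_sum polys_cmult) auto
qed

lemma real_polynomial_function_polys:
  assumes "q \<in> polys d"
  shows "real_polynomial_function q"
proof -
  obtain c where q: "q = (\<lambda>x. \<Sum>\<beta>\<in>multi_indices d. c \<beta> * mi_monom \<beta> x)"
    using assms by (rule polysE)
  show ?thesis
    unfolding q mi_monom_def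
    by (intro real_polynomial_function_sum real_polynomial_function.intros(4)
      real_polynomial_function.intros(2) real_polynomial_function_prod real_polynomial_function_power
      real_polynomial_function.intros(1) bounded_linear_vec_nth finite_multi_indices finite)
qed

lemma continuous_on_polys: "q \<in> polys d \<Longrightarrow> continuous_on S q"
  using real_polynomial_function_polys continuous_on_polymonial_function real_polynomial_function_eq
  by blast

text \<open>Along the line through a point of the open set the polynomial restricts to a polynomial in
  one variable with infinitely many zeros.\<close>

lemma polynomial_zero_on_open_imp_zero:
  fixes q :: "'a::real_normed_vector \<Rightarrow> real"
  assumes "real_polynomial_function q" "open U" "a \<in> U" "\<And>x. x \<in> U \<Longrightarrow> q x = 0"
  shows "q x = 0"
proof -
  define h where "h t = q (a + t *\<^sub>R (x - a))" for t :: real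
  have "polynomial_function (\<lambda>t::real. a + t *\<^sub>R (x - a))"
    by (intro polynomial_function_add polynomial_function_mult) auto
  then have "real_polynomial_function (q \<circ> (\<lambda>t::real. a + t *\<^sub>R (x - a)))"
    using assms(1) by (rule real_polynomial_function_compose)
  then obtain c n where c: "h = (\<lambda>t. \<Sum>i\<le>n. c i * t ^ i)"
    unfolding h_def o_def real_polynomial_function_iff_sum by blast
  have "((\<lambda>t::real. a + t *\<^sub>R (x - a)) \<longlongrightarrow> a + 0 *\<^sub>R (x - a)) (at 0)"
    by (intro tendsto_intros)
  then have "\<forall>\<^sub>F t in at (0::real). a + t *\<^sub>R (x - a) \<in> U"
    using topological_tendstoD[OF _ assms(2)] assms(3) by fastforce
  then obtain e where e: "e > 0" "\<And>t. t \<noteq> 0 \<Longrightarrow> \<bar>t\<bar> < e \<Longrightarrow> a + t *\<^sub>R (x - a) \<in> U"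
    unfolding eventually_at by (auto simp: dist_norm)
  have "{0<..<e} \<subseteq> {t. h t = 0}"
    using e by (auto simp: h_def intro!: assms(4))
  then have "infinite {t. h t = 0}"
    using infinite_Ioo[OF e(1)] finite_subset by blast
  then have "\<forall>i\<le>n. c i = 0"
    unfolding c using polyfun_rootbound by metis
  then have "h 1 = 0" by (simp add: c)
  then show ?thesis by (simp add: h_def)
qed

section \<open>Square-integrable functions and orthogonal projection\<close>

definition square_integrable :: "'a measure \<Rightarrow> ('a \<Rightarrow> real) \<Rightarrow> bool"
  where "square_integrable M f \<longleftrightarrow> f \<in> borel_measurable M \<and> integrable M (\<lambda>x. (f x)\<^sup>2)"

lemma square_integrable_mult:
  assumes "square_integrable M f" "square_integrable M g"
  shows "integrable M (\<lambda>x. f x * g x)"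
proof (rule Bochner_Integration.integrable_bound)
  show "integrable M (\<lambda>x. (f x)\<^sup>2 + (g x)\<^sup>2)"
    using assms by (auto simp: square_integrable_def)
  show "(\<lambda>x. f x * g x) \<in> borel_measurable M"
    using assms by (auto simp: square_integrable_def)
  have "\<bar>u * v\<bar> \<le> u\<^sup>2 + v\<^sup>2" for u v :: real
    using sum_squares_bound[of u v] sum_squares_bound[of u "-v"] by (auto simp: abs_le_iff) 
  then show "AE x in M. norm (f x * g x) \<le> norm ((f x)\<^sup>2 + (g x)\<^sup>2)"
    by simp
qed

lemma square_integrable_add:
  assumes "square_integrable M f" "square_integrable M g"
  shows "square_integrable M (\<lambda>x. f x + g x)"
  using assms square_integrable_mult[OF assms]
  by (auto simp: square_integrable_def power2_sum mult.assoc)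

lemma square_integrable_cmult:
  "square_integrable M f \<Longrightarrow> square_integrable M (\<lambda>x. a * f x)"
  by (auto simp: square_integrable_def power_mult_distrib)

lemma square_integrable_diff:
  assumes "square_integrable M f" "square_integrable M g"
  shows "square_integrable M (\<lambda>x. f x - g x)"
  using square_integrable_add[OF assms(1) square_integrable_cmult[OF assms(2), of "-1"]] by simp

lemma square_integrable_sum:
  assumes "\<And>i. i \<in> I \<Longrightarrow> square_integrable M (f i)"
  shows "square_integrable M (\<lambda>x. \<Sum>i\<in>I. f i x)"
  using assms
  by (induction I rule: infinite_finite_induct)
    (auto intro: square_integrable_add simp: square_integrable_def[of _ "\<lambda>x. 0"])

text \<open>The discriminant of the nonnegative quadratic \<open>t \<mapsto> \<integral> (f - t g)\<^sup>2\<close>.\<close>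

lemma Cauchy_Schwarz_integral:
  assumes f: "square_integrable M f" and g: "square_integrable M g"
  shows "(\<integral>x. f x * g x \<partial>M)\<^sup>2 \<le> (\<integral>x. (f x)\<^sup>2 \<partial>M) * (\<integral>x. (g x)\<^sup>2 \<partial>M)"
proof -
  let ?A = "\<integral>x. (f x)\<^sup>2 \<partial>M" and ?B = "\<integral>x. f x * g x \<partial>M" and ?C = "\<integral>x. (g x)\<^sup>2 \<partial>M"
  have q: "0 \<le> ?A - 2 * t * ?B + t\<^sup>2 * ?C" for t
  proof -
    have "0 \<le> (\<integral>x. (f x - t * g x)\<^sup>2 \<partial>M)" by simp
    also have "(\<lambda>x. (f x - t * g x)\<^sup>2) = (\<lambda>x. (f x)\<^sup>2 - 2 * t * (f x * g x) + t\<^sup>2 * (g x)\<^sup>2)"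
      by (auto simp: power2_eq_square algebra_simps)
    also have "(\<integral>x. (f x)\<^sup>2 - 2 * t * (f x * g x) + t\<^sup>2 * (g x)\<^sup>2 \<partial>M) = ?A - 2 * t * ?B + t\<^sup>2 * ?C"
      using f g square_integrable_mult[OF f g] by (simp add: square_integrable_def)
    finally show ?thesis .
  qed
  show ?thesis
  proof (cases "?C = 0")
    case True
    show ?thesis
    proof (cases "?B = 0")
      case False
      \<comment> \<open>a nonconstant affine function of \<open>t\<close> cannot be nonnegative\<close>
      then show ?thesis using q[of "(?A + 1) / (2 * ?B)"] True by simp
    qed (simp add: True)
  next
    case False
    then have "?C > 0" by (simp add: order_less_le)
    then show ?thesis using q[of "?B / ?C"]
      by (simp add: power2_eq_square field_simps)
  qed
qed

text \<open>Gram--Schmidt, without normalising: a new function \<open>f\<close> contributes only through its residual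
  with respect to the previous ones, and a residual of norm zero contributes nothing by
  Cauchy--Schwarz.\<close>

lemma orthogonal_projection_exists:
  assumes "finite B" "\<And>b. b \<in> B \<Longrightarrow> square_integrable M (e b)" "square_integrable M g"
  shows "\<exists>c. \<forall>b\<in>B. (\<integral>x. (g x - (\<Sum>b\<in>B. c b * e b x)) * e b x \<partial>M) = 0"
  using assms
proof (induction B arbitrary: g)
  case empty
  then show ?case by simp
next
  case (insert a B)
  have sqB: "square_integrable M (\<lambda>x. \<Sum>b\<in>B. c b * e b x)" for c
    using insert.prems by (intro square_integrable_sum square_integrable_cmult) auto
  have sqa: "square_integrable M (e a)" using insert.prems by auto
  obtain c where c: "\<forall>b\<in>B. (\<integral>x. (g x - (\<Sum>b\<in>B. c b * e b x)) * e b x \<partial>M) = 0"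
    using insert.IH[of g] insert.prems by auto
  obtain d where d: "\<forall>b\<in>B. (\<integral>x. (e a x - (\<Sum>b\<in>B. d b * e b x)) * e b x \<partial>M) = 0"
    using insert.IH[of "e a"] insert.prems by auto
  define r where "r x = e a x - (\<Sum>b\<in>B. d b * e b x)" for x
  define u where "u x = g x - (\<Sum>b\<in>B. c b * e b x)" for x
  have r: "square_integrable M r" and u: "square_integrable M u"
    unfolding r_def u_def using sqa sqB insert.prems by (auto intro: square_integrable_diff)
  let ?R = "\<integral>x. (r x)\<^sup>2 \<partial>M"
  define t where "t = (\<integral>x. u x * r x \<partial>M) / ?R"
  define c' where "c' b = (if b = a then t else c b - t * d b)" for b
  have sum_c': "(\<Sum>b\<in>insert a B. c' b * e b x) = t * e a x + (\<Sum>b\<in>B. (c b - t * d b) * e b x)" for x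
  proof -
    have "(\<Sum>b\<in>B. c' b * e b x) = (\<Sum>b\<in>B. (c b - t * d b) * e b x)"
      using insert.hyps by (intro sum.cong) (auto simp: c'_def)
    then show ?thesis using insert.hyps by (simp add: c'_def)
  qed
  have res: "g x - (\<Sum>b\<in>insert a B. c' b * e b x) = u x - t * r x" for x
    unfolding sum_c' u_def r_def
    by (simp add: sum_subtractf algebra_simps sum_distrib_left)
  have ortho_B: "(\<integral>x. (u x - t * r x) * e b x \<partial>M) = 0" if "b \<in> B" for b
  proof -
    have eb: "square_integrable M (e b)" using insert.prems that by auto
    have "(\<integral>x. (u x - t * r x) * e b x \<partial>M) = (\<integral>x. u x * e b x - t * (r x * e b x) \<partial>M)"
      by (simp add: algebra_simps)
    also have "\<dots> = 0"
      using square_integrable_mult[OF u eb] square_integrable_mult[OF r eb] bspec[OF c that] bspec[OF d that]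
      by (simp add: u_def r_def)
    finally show ?thesis .
  qed
  have ortho_r: "(\<integral>x. (u x - t * r x) * r x \<partial>M) = 0"
  proof -
    have "(\<integral>x. (u x - t * r x) * r x \<partial>M) = (\<integral>x. u x * r x - t * (r x)\<^sup>2 \<partial>M)"
      by (simp add: algebra_simps power2_eq_square)
    also have "\<dots> = (\<integral>x. u x * r x \<partial>M) - t * ?R"
      using square_integrable_mult[OF u r] r by (simp add: square_integrable_def)
    also have "\<dots> = 0"
      using Cauchy_Schwarz_integral[OF u r] by (cases "?R = 0") (auto simp: t_def)
    finally show ?thesis .
  qed
  have ortho_a: "(\<integral>x. (u x - t * r x) * e a x \<partial>M) = 0"
  proof -
    define w where "w x = u x - t * r x" for x
    have w: "square_integrable M w"
      unfolding w_def by (intro square_integrable_diff square_integrable_cmult u r)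
    have wb: "integrable M (\<lambda>x. w x * e b x)" if "b \<in> B" for b
      using insert.prems that by (intro square_integrable_mult w) auto
    have "(\<lambda>x. w x * e a x) = (\<lambda>x. w x * r x + (\<Sum>b\<in>B. d b * (w x * e b x)))"
      by (auto simp: r_def sum_distrib_left algebra_simps)
    then have "(\<integral>x. w x * e a x \<partial>M) = 0"
      using wb square_integrable_mult[OF w r] ortho_r ortho_B
      by (simp add: Bochner_Integration.integral_sum w_def[symmetric])
    then show ?thesis by (simp add: w_def)
  qed
  show ?case
    by (rule exI[of _ c']) (use ortho_B ortho_a in \<open>auto simp only: res ball_simps insert_iff\<close>)
qed

section \<open>The approximating polynomial of a cube\<close>

lemma set_lebesgue_integral_lebesgue_on:
  fixes f :: "'a::euclidean_space \<Rightarrow> real"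
  assumes "Q \<in> sets lebesgue"
  shows "(LINT y:Q|lebesgue. f y) = (\<integral>y. f y \<partial>lebesgue_on Q)"
  using assms by (simp add: set_lebesgue_integral_def integral_restrict_space)

lemma locally_square_integrable_on_cbox:
  assumes "locally_square_integrable g"
  shows "square_integrable (lebesgue_on (cbox a b)) g"
proof -
  have "set_integrable lebesgue (cbox a b) (\<lambda>x. (g x)\<^sup>2)"
    using assms by (auto simp: locally_square_integrable_def)
  then show ?thesis
    using assms
    by (auto simp: square_integrable_def locally_square_integrable_def integrable_restrict_space
      set_integrable_def intro: measurable_restrict_space1)
qed

lemma continuous_square_integrable:
  fixes q :: "'a::euclidean_space \<Rightarrow> real"
  assumes "continuous_on (cbox a b) q"
  shows "square_integrable (lebesgue_on (cbox a b)) q"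
proof -
  have "integrable (lebesgue_on (cbox a b)) (\<lambda>x. (q x)\<^sup>2)" "integrable (lebesgue_on (cbox a b)) q"
    by (intro continuous_imp_integrable continuous_intros assms)+
  then show ?thesis
    by (auto simp: square_integrable_def dest: borel_measurable_integrable)
qed

lemma polys_square_integrable:
  "q \<in> polys d \<Longrightarrow> square_integrable (lebesgue_on (cbox a b)) q"
  by (intro continuous_square_integrable continuous_on_polys)

text \<open>Vanishing moments are orthogonality to all polynomials of the given degree, which turns
  \<open>proj_poly\<close> into an orthogonal projection in \<open>L\<^sup>2\<close> of the cube.\<close>

lemma vanishing_moments_cbox_iff:
  assumes "square_integrable (lebesgue_on (cbox a b)) h"
  shows "vanishing_moments m (\<lambda>x. h x * indicator (cbox a b) x) \<longleftrightarrow>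
    (\<forall>q\<in>polys m. (\<integral>x. h x * q x \<partial>lebesgue_on (cbox a b)) = 0)"
proof -
  let ?M = "lebesgue_on (cbox a b)"
  have int: "integrable ?M (\<lambda>x. h x * q x)" if "q \<in> polys m" for q
    using assms polys_square_integrable[OF that] by (rule square_integrable_mult)
  have monom: "has_bochner_integral lebesgue (\<lambda>x. h x * indicator (cbox a b) x * mi_monom \<beta> x) 0 \<longleftrightarrow>
      (\<integral>x. h x * mi_monom \<beta> x \<partial>?M) = 0" if "\<beta> \<in> multi_indices m" for \<beta>
    using int[OF mi_monom_in_polys[OF that]]
    by (simp add: has_bochner_integral_iff integrable_restrict_space integral_restrict_space
      mult.assoc mult.left_commute)
  have "(\<integral>x. h x * q x \<partial>?M) = 0"
    if z: "\<And>\<beta>. \<beta> \<in> multi_indices m \<Longrightarrow> (\<integral>x. h x * mi_monom \<beta> x \<partial>?M) = 0" and "q \<in> polys m" for q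
  proof -
    obtain c where q: "q = (\<lambda>x. \<Sum>\<beta>\<in>multi_indices m. c \<beta> * mi_monom \<beta> x)"
      using \<open>q \<in> polys m\<close> by (rule polysE)
    have "(\<integral>x. h x * q x \<partial>?M) = (\<integral>x. (\<Sum>\<beta>\<in>multi_indices m. c \<beta> * (h x * mi_monom \<beta> x)) \<partial>?M)"
      by (simp add: q sum_distrib_left mult.left_commute)
    also have "\<dots> = (\<Sum>\<beta>\<in>multi_indices m. c \<beta> * (\<integral>x. h x * mi_monom \<beta> x \<partial>?M))"
      by (subst Bochner_Integration.integral_sum) (auto intro: int mi_monom_in_polys)
    finally show ?thesis using z by simp
  qed
  then show ?thesis
    unfolding vanishing_moments_def using monom mi_monom_in_polys by blast
qed

text \<open>By continuity, a polynomial that vanishes almost everywhere on a nondegenerate box vanishes on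
  its interior. This makes the approximating polynomial unique as a function, as the definite
  description in \<open>proj_poly\<close> demands.\<close>

lemma polys_zero_if_L2_zero:
  assumes "q \<in> polys m" "box a b \<noteq> {}" "(\<integral>x. (q x)\<^sup>2 \<partial>lebesgue_on (cbox a b)) = 0"
  shows "q = (\<lambda>x. 0)"
proof -
  have "AE x in lebesgue_on (cbox a b). (q x)\<^sup>2 = 0"
    using assms(3) polys_square_integrable[OF assms(1), of a b]
    by (subst (asm) integral_nonneg_eq_0_iff_AE) (auto simp: square_integrable_def)
  then have ae: "AE x in lebesgue. x \<in> cbox a b \<longrightarrow> q x = 0"
    by (simp add: AE_restrict_space_iff)
  define V where "V = {x\<in>box a b. q x \<in> - {0}}"
  have "open V"
    unfolding V_def
    by (intro continuous_open_preimage[unfolded vimage_def Int_def, simplified] continuous_on_polys)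
      (use assms(1) in \<open>auto intro: continuous_on_polys\<close>)
  moreover have "negligible V"
  proof -
    have "AE x in lebesgue. x \<notin> V"
      using ae by eventually_elim (use box_subset_cbox in \<open>auto simp: V_def\<close>)
    then show ?thesis
      using \<open>open V\<close> by (simp add: negligible_iff_null_sets AE_iff_null_sets lborelD)
  qed
  ultimately have V: "V = {}" using open_not_negligible by blast
  have "q x = 0" if "x \<in> box a b" for x using that V by (auto simp: V_def)
  moreover obtain z where "z \<in> box a b" using assms(2) by blast
  ultimately have "q x = 0" for x
    using polynomial_zero_on_open_imp_zero[OF real_polynomial_function_polys[OF assms(1)] open_box]
    by metis
  then show ?thesis by blast
qed

lemma proj_poly_cbox:
  assumes g: "square_integrable (lebesgue_on (cbox a b)) g" and ne: "box a b \<noteq> {}"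
  shows proj_poly_in_polys: "proj_poly \<alpha> (cbox a b) g \<in> polys (intpart \<alpha>)"
    and proj_poly_orthogonal: "\<And>q. q \<in> polys (intpart \<alpha>) \<Longrightarrow>
      (\<integral>x. (g x - proj_poly \<alpha> (cbox a b) g x) * q x \<partial>lebesgue_on (cbox a b)) = 0"
proof -
  let ?M = "lebesgue_on (cbox a b)" and ?m = "intpart \<alpha>"
  let ?P = "\<lambda>q. q \<in> polys ?m \<and> vanishing_moments ?m (\<lambda>x. (g x - q x) * indicator (cbox a b) x)"
  have iff: "?P q \<longleftrightarrow> q \<in> polys ?m \<and> (\<forall>r\<in>polys ?m. (\<integral>x. (g x - q x) * r x \<partial>?M) = 0)" for q
    using vanishing_moments_cbox_iff[OF square_integrable_diff[OF g polys_square_integrable[of q ?m]]]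
    by blast
  obtain c where c: "\<forall>\<beta>\<in>multi_indices ?m.
      (\<integral>x. (g x - (\<Sum>\<beta>\<in>multi_indices ?m. c \<beta> * mi_monom \<beta> x)) * mi_monom \<beta> x \<partial>?M) = 0"
    using orthogonal_projection_exists[OF finite_multi_indices _ g, of ?m mi_monom]
      mi_monom_in_polys polys_square_integrable by blast
  define q where "q x = (\<Sum>\<beta>\<in>multi_indices ?m. c \<beta> * mi_monom \<beta> x)" for x
  have q: "q \<in> polys ?m" by (rule polysI[of _ c]) (simp add: q_def fun_eq_iff)
  have gq: "square_integrable ?M (\<lambda>x. g x - q x)"
    by (rule square_integrable_diff[OF g polys_square_integrable[OF q]])
  have "?P q"
  proof -
    have "has_bochner_integral lebesgue (\<lambda>x. (g x - q x) * indicator (cbox a b) x * mi_monom \<beta> x) 0"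
      if "\<beta> \<in> multi_indices ?m" for \<beta>
      using c that square_integrable_mult[OF gq polys_square_integrable[OF mi_monom_in_polys[OF that]]]
      by (simp add: q_def has_bochner_integral_iff integrable_restrict_space integral_restrict_space
        mult.assoc mult.left_commute)
    then show ?thesis using q by (auto simp: vanishing_moments_def)
  qed
  moreover have "q' = q" if "?P q'" for q'
  proof -
    have q': "q' \<in> polys ?m" using that by simp
    define d where "d x = q' x - q x" for x
    have d: "d \<in> polys ?m" unfolding d_def by (intro polys_diff q q')
    have "(\<integral>x. (d x)\<^sup>2 \<partial>?M) = (\<integral>x. (g x - q x) * d x - (g x - q' x) * d x \<partial>?M)"
      by (simp add: d_def power2_eq_square algebra_simps)
    also have "\<dots> = (\<integral>x. (g x - q x) * d x \<partial>?M) - (\<integral>x. (g x - q' x) * d x \<partial>?M)"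
      by (intro Bochner_Integration.integral_diff square_integrable_mult square_integrable_diff g
        polys_square_integrable[OF q] polys_square_integrable[OF q'] polys_square_integrable[OF d])
    also have "\<dots> = 0" using \<open>?P q\<close> that d unfolding iff by simp
    finally have "d = (\<lambda>x. 0)" using polys_zero_if_L2_zero[OF d ne] by simp
    then show ?thesis by (simp add: d_def fun_eq_iff)
  qed
  ultimately have "?P (proj_poly \<alpha> (cbox a b) g)"
    unfolding proj_poly_def by (rule theI[of ?P])
  then show "proj_poly \<alpha> (cbox a b) g \<in> polys ?m"
    "\<And>q. q \<in> polys ?m \<Longrightarrow> (\<integral>x. (g x - proj_poly \<alpha> (cbox a b) g x) * q x \<partial>?M) = 0"
    unfolding iff by auto
qed

definition poly_error :: "real \<Rightarrow> (real ^ 'n::finite) set \<Rightarrow> (real ^ 'n \<Rightarrow> real) \<Rightarrow> real"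
  where "poly_error \<alpha> Q g = (\<integral>x. (g x - proj_poly \<alpha> Q g x)\<^sup>2 \<partial>lebesgue_on Q)"

lemma poly_error_nonneg: "0 \<le> poly_error \<alpha> Q g"
  by (simp add: poly_error_def)

text \<open>By Pythagoras, the orthogonal projection is the best approximation. Monotonicity of the error
  in the cube and its covariance under affine maps both rest on this minimality.\<close>

lemma poly_error_le:
  assumes g: "square_integrable (lebesgue_on (cbox a b)) g" and ne: "box a b \<noteq> {}"
    and q: "q \<in> polys (intpart \<alpha>)"
  shows "poly_error \<alpha> (cbox a b) g \<le> (\<integral>x. (g x - q x)\<^sup>2 \<partial>lebesgue_on (cbox a b))"
proof -
  let ?M = "lebesgue_on (cbox a b)" 
  define P where "P = proj_poly \<alpha> (cbox a b) g"
  have P: "P \<in> polys (intpart \<alpha>)" unfolding P_def by (rule proj_poly_in_polys[OF g ne])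
  have r: "(\<lambda>x. P x - q x) \<in> polys (intpart \<alpha>)" by (rule polys_diff[OF P q])
  note sq = square_integrable_diff[OF g polys_square_integrable[OF P]] polys_square_integrable[OF r, of a b]
  have i: "integrable ?M (\<lambda>x. (g x - P x)\<^sup>2)" "integrable ?M (\<lambda>x. (P x - q x)\<^sup>2)"
    "integrable ?M (\<lambda>x. (g x - P x) * (P x - q x))"
    using sq square_integrable_mult[OF sq] by (auto simp: square_integrable_def)
  have "(\<lambda>x. (g x - q x)\<^sup>2) = (\<lambda>x. (g x - P x)\<^sup>2 + (P x - q x)\<^sup>2 + 2 * ((g x - P x) * (P x - q x)))"
    by (auto simp: power2_eq_square algebra_simps)
  then have "(\<integral>x. (g x - q x)\<^sup>2 \<partial>?M) =
      poly_error \<alpha> (cbox a b) g + (\<integral>x. (P x - q x)\<^sup>2 \<partial>?M) + 2 * (\<integral>x. (g x - P x) * (P x - q x) \<partial>?M)"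
    using i by (simp add: poly_error_def P_def)
  also have "(\<integral>x. (g x - P x) * (P x - q x) \<partial>?M) = 0"
    using proj_poly_orthogonal[OF g ne r] by (simp add: P_def)
  finally show ?thesis by simp
qed

lemma poly_error_mono:
  assumes g: "square_integrable (lebesgue_on (cbox a' b')) g"
    and ne: "box a b \<noteq> {}" and sub: "cbox a b \<subseteq> cbox a' b'"
  shows "poly_error \<alpha> (cbox a b) g \<le> poly_error \<alpha> (cbox a' b') g"
proof -
  let ?P = "proj_poly \<alpha> (cbox a' b') g"
  have ne': "box a' b' \<noteq> {}"
    using ne sub by (metis interior_cbox interior_mono subset_empty)
  have P: "?P \<in> polys (intpart \<alpha>)" by (rule proj_poly_in_polys[OF g ne'])
  have restrict: "integrable (lebesgue_on (cbox a b)) f" if "integrable (lebesgue_on (cbox a' b')) f" for f :: "real ^ 'a \<Rightarrow> real"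
    using that set_integrable_subset[of lebesgue "cbox a' b'" f "cbox a b"] sub
    by (simp add: integrable_restrict_space set_integrable_def)
  have g': "square_integrable (lebesgue_on (cbox a b)) g"
  proof -
    have "g \<in> borel_measurable (lebesgue_on (cbox a b))"
      using g sub by (auto simp: square_integrable_def intro: measurable_restrict_mono)
    then show ?thesis
      using g restrict[of "\<lambda>x. (g x)\<^sup>2"] by (simp add: square_integrable_def)
  qed
  have i: "integrable (lebesgue_on (cbox a' b')) (\<lambda>x. (g x - ?P x)\<^sup>2)"
    using square_integrable_diff[OF g polys_square_integrable[OF P]] by (simp add: square_integrable_def)
  have "poly_error \<alpha> (cbox a b) g \<le> (\<integral>x. (g x - ?P x)\<^sup>2 \<partial>lebesgue_on (cbox a b))"
    by (rule poly_error_le[OF g' ne P])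
  also have "\<dots> \<le> (\<integral>x. (g x - ?P x)\<^sup>2 \<partial>lebesgue_on (cbox a' b'))"
  proof -
    have "(\<integral>x. indicator (cbox a b) x * (g x - ?P x)\<^sup>2 \<partial>lebesgue) \<le>
        (\<integral>x. indicator (cbox a' b') x * (g x - ?P x)\<^sup>2 \<partial>lebesgue)"
      using i restrict[OF i] sub
      by (intro integral_mono) (auto simp: integrable_restrict_space indicator_def)
    then show ?thesis by (simp add: integral_restrict_space)
  qed
  finally show ?thesis by (simp add: poly_error_def)
qed

section \<open>Affine changes of variables\<close>

lemma lebesgue_affine_cart:
  fixes t :: "real ^ 'n::finite"
  assumes "r > 0"
  shows measurable_affine_cart: "(\<lambda>x. t + r *\<^sub>R x) \<in> lebesgue \<rightarrow>\<^sub>M lebesgue"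
    and lebesgue_eq_affine_image: "(lebesgue :: (real ^ 'n) measure) =
      density (distr lebesgue lebesgue (\<lambda>x. t + r *\<^sub>R x)) (\<lambda>_. ennreal (r ^ CARD('n)))"
proof -
  have T: "t + (\<Sum>j\<in>Basis. (r * (x \<bullet> j)) *\<^sub>R j) = t + r *\<^sub>R x" for x :: "real ^ 'n"
    by (simp add: scaleR_scaleR[symmetric] scaleR_sum_right[symmetric] euclidean_representation
      del: scaleR_scaleR)
  show "(\<lambda>x. t + r *\<^sub>R x) \<in> lebesgue \<rightarrow>\<^sub>M lebesgue"
    using lebesgue_affine_measurable[of "\<lambda>_. r" t] assms by (simp add: T)
  show "(lebesgue :: (real ^ 'n) measure) =
      density (distr lebesgue lebesgue (\<lambda>x. t + r *\<^sub>R x)) (\<lambda>_. ennreal (r ^ CARD('n)))"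
    using lebesgue_affine_euclidean[of "\<lambda>_. r" t] assms by (simp add: T)
qed

lemma
  fixes f :: "real ^ 'n::finite \<Rightarrow> real"
  assumes r: "r > 0" and f: "f \<in> borel_measurable lebesgue"
  shows integrable_affine_cart_iff:
      "integrable lebesgue (\<lambda>x. f (t + r *\<^sub>R x)) \<longleftrightarrow> integrable lebesgue f"
    and integral_affine_cart:
      "(\<integral>y. f y \<partial>lebesgue) = r ^ CARD('n) * (\<integral>x. f (t + r *\<^sub>R x) \<partial>lebesgue)"
proof -
  note [measurable] = measurable_affine_cart[OF r, of t] f
  show "integrable lebesgue (\<lambda>x. f (t + r *\<^sub>R x)) \<longleftrightarrow> integrable lebesgue f"
    using r by (subst (2) lebesgue_eq_affine_image[OF r, of t])
      (simp add: integrable_density integrable_distr_eq)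
  show "(\<integral>y. f y \<partial>lebesgue) = r ^ CARD('n) * (\<integral>x. f (t + r *\<^sub>R x) \<partial>lebesgue)"
    using r by (subst lebesgue_eq_affine_image[OF r, of t])
      (simp add: integral_density integral_distr)
qed

lemma affine_in_cbox_iff:
  fixes t a b x :: "real ^ 'n::finite"
  assumes "r > 0"
  shows "t + r *\<^sub>R x \<in> cbox (t + r *\<^sub>R a) (t + r *\<^sub>R b) \<longleftrightarrow> x \<in> cbox a b"
  using assms by (simp add: mem_box_cart)

lemma box_affine_nonempty_iff:
  fixes t a b :: "real ^ 'n::finite"
  assumes "r > 0"
  shows "box (t + r *\<^sub>R a) (t + r *\<^sub>R b) \<noteq> {} \<longleftrightarrow> box a b \<noteq> {}"
  using assms by (simp add: box_ne_empty inner_add_left)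

lemma square_integrable_affine:
  fixes G :: "real ^ 'n::finite \<Rightarrow> real"
  assumes r: "r > 0" and G: "square_integrable (lebesgue_on (cbox (t + r *\<^sub>R a) (t + r *\<^sub>R b))) G"
  shows "square_integrable (lebesgue_on (cbox a b)) (\<lambda>x. G (t + r *\<^sub>R x))"
    and "(\<integral>y. (G y)\<^sup>2 \<partial>lebesgue_on (cbox (t + r *\<^sub>R a) (t + r *\<^sub>R b))) =
      r ^ CARD('n) * (\<integral>x. (G (t + r *\<^sub>R x))\<^sup>2 \<partial>lebesgue_on (cbox a b))"
proof -
  let ?R = "cbox (t + r *\<^sub>R a) (t + r *\<^sub>R b)"
  have ind: "indicator ?R (t + r *\<^sub>R x) = (indicator (cbox a b) x :: real)" for x
    by (simp add: indicator_def affine_in_cbox_iff[OF r])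
  have m: "(\<lambda>y. indicator ?R y * G y) \<in> borel_measurable lebesgue"
    using G by (simp add: square_integrable_def borel_measurable_restrict_space_iff)
  have i: "integrable lebesgue (\<lambda>y. indicator ?R y * (G y)\<^sup>2)"
    using G by (simp add: square_integrable_def integrable_restrict_space)
  have m': "(\<lambda>y. indicator ?R y * (G y)\<^sup>2) \<in> borel_measurable lebesgue"
    using i by (rule borel_measurable_integrable)
  have "(\<lambda>x. indicator (cbox a b) x * G (t + r *\<^sub>R x)) \<in> borel_measurable lebesgue"
    using measurable_compose[OF measurable_affine_cart[OF r, of t] m] by (simp add: ind)
  then show "square_integrable (lebesgue_on (cbox a b)) (\<lambda>x. G (t + r *\<^sub>R x))"
    using integrable_affine_cart_iff[OF r m', of t] i
    by (simp add: square_integrable_def borel_measurable_restrict_space_iff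
      integrable_restrict_space ind)
  show "(\<integral>y. (G y)\<^sup>2 \<partial>lebesgue_on ?R) = r ^ CARD('n) * (\<integral>x. (G (t + r *\<^sub>R x))\<^sup>2 \<partial>lebesgue_on (cbox a b))"
    using integral_affine_cart[OF r m', of t] by (simp add: integral_restrict_space ind)
qed

lemma poly_error_affine_le:
  fixes G :: "real ^ 'n::finite \<Rightarrow> real"
  assumes r: "r > 0" and G: "square_integrable (lebesgue_on (cbox (t + r *\<^sub>R a) (t + r *\<^sub>R b))) G"
    and ne: "box a b \<noteq> {}"
  shows "r ^ CARD('n) * poly_error \<alpha> (cbox a b) (\<lambda>x. G (t + r *\<^sub>R x)) \<le>
    poly_error \<alpha> (cbox (t + r *\<^sub>R a) (t + r *\<^sub>R b)) G"
proof -
  define P where "P = proj_poly \<alpha> (cbox (t + r *\<^sub>R a) (t + r *\<^sub>R b)) G"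
  have P: "P \<in> polys (intpart \<alpha>)"
    unfolding P_def using G ne r by (intro proj_poly_in_polys) (simp_all add: box_affine_nonempty_iff)
  have "poly_error \<alpha> (cbox a b) (\<lambda>x. G (t + r *\<^sub>R x)) \<le>
      (\<integral>x. (G (t + r *\<^sub>R x) - P (t + r *\<^sub>R x))\<^sup>2 \<partial>lebesgue_on (cbox a b))"
    by (intro poly_error_le square_integrable_affine(1) r G ne polys_affine P)
  also have "r ^ CARD('n) * \<dots> = poly_error \<alpha> (cbox (t + r *\<^sub>R a) (t + r *\<^sub>R b)) G"
    using square_integrable_affine(2)[OF r square_integrable_diff[OF G polys_square_integrable[OF P]]]
    by (simp add: poly_error_def P_def)
  finally show ?thesis using r by simp
qed

text \<open>The reverse inequality is the same one for the inverse map.\<close>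

lemma poly_error_affine:
  fixes G :: "real ^ 'n::finite \<Rightarrow> real"
  assumes r: "r > 0" and G: "square_integrable (lebesgue_on (cbox (t + r *\<^sub>R a) (t + r *\<^sub>R b))) G"
    and ne: "box a b \<noteq> {}"
  shows "poly_error \<alpha> (cbox (t + r *\<^sub>R a) (t + r *\<^sub>R b)) G =
    r ^ CARD('n) * poly_error \<alpha> (cbox a b) (\<lambda>x. G (t + r *\<^sub>R x))"
proof (rule antisym)
  let ?H = "\<lambda>x. G (t + r *\<^sub>R x)" and ?s = "inverse r" and ?u = "- (inverse r *\<^sub>R t)"
  have inv: "?u + ?s *\<^sub>R (t + r *\<^sub>R x) = x" "t + r *\<^sub>R (?u + ?s *\<^sub>R x) = x" for x
    using r by (simp_all add: algebra_simps)
  have "?s ^ CARD('n) * poly_error \<alpha> (cbox (t + r *\<^sub>R a) (t + r *\<^sub>R b)) (\<lambda>y. ?H (?u + ?s *\<^sub>R y)) \<le>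
      poly_error \<alpha> (cbox (?u + ?s *\<^sub>R (t + r *\<^sub>R a)) (?u + ?s *\<^sub>R (t + r *\<^sub>R b))) ?H"
    using r G ne square_integrable_affine(1)[OF r G]
    by (intro poly_error_affine_le) (simp_all only: inv box_affine_nonempty_iff, simp_all)
  then show "poly_error \<alpha> (cbox (t + r *\<^sub>R a) (t + r *\<^sub>R b)) G \<le>
      r ^ CARD('n) * poly_error \<alpha> (cbox a b) ?H"
    unfolding inv using r by (simp add: field_simps)
qed (rule poly_error_affine_le[OF assms])

section \<open>The Lipschitz seminorm as a supremum over cubes\<close>

definition oscillation :: "real \<Rightarrow> (real ^ 'n::finite) set \<Rightarrow> (real ^ 'n \<Rightarrow> real) \<Rightarrow> real"
  where "oscillation \<alpha> Q g = 1 / (measure lebesgue Q powr (\<alpha> / real CARD('n))) *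
    sqrt (1 / measure lebesgue Q * poly_error \<alpha> Q g)"

lemma cubesE:
  assumes "Q \<in> cubes"
  obtains a s where "s > 0" "Q = cbox a (\<chi> i. a $ i + s)"
  using assms by (auto simp: cubes_def)

lemma cubesI: "s > 0 \<Longrightarrow> Q = cbox a (\<chi> i. a $ i + s) \<Longrightarrow> Q \<in> cubes"
  by (auto simp: cubes_def)

lemma box_cube_nonempty: "s > 0 \<Longrightarrow> box a (\<chi> i. a $ i + s) \<noteq> ({} :: (real ^ 'n::finite) set)"
  by (auto simp: box_ne_empty Basis_vec_def inner_axis)

lemma measure_cube:
  assumes "s > 0"
  shows "measure lebesgue (cbox a (\<chi> i. a $ i + s) :: (real ^ 'n::finite) set) = s ^ CARD('n)"
proof -
  have "cbox a (\<chi> i. a $ i + s) \<noteq> {}"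
    using box_cube_nonempty[OF assms, of a] box_subset_cbox by blast
  then show ?thesis by (simp add: content_cbox_cart)
qed

lemma oscillation_cube:
  assumes "s > 0"
  shows "oscillation \<alpha> (cbox a (\<chi> i. a $ i + s) :: (real ^ 'n::finite) set) g =
    s powr (- \<alpha>) * sqrt (poly_error \<alpha> (cbox a (\<chi> i. a $ i + s)) g / s ^ CARD('n))"
proof -
  have "(s ^ CARD('n)) powr (\<alpha> / real CARD('n)) = s powr \<alpha>"
    using assms by (simp add: powr_realpow[symmetric] powr_powr)
  then show ?thesis
    unfolding oscillation_def measure_cube[OF assms] by (simp add: powr_minus field_simps)
qed

lemma sharp_max_eq_SUP_oscillation:
  assumes "J \<subseteq> cubes"
  shows "sharp_max \<alpha> J g x = (SUP Q\<in>{Q\<in>J. x \<in> Q}. ennreal (oscillation \<alpha> Q g))"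
proof -
  have "Q \<in> sets lebesgue" if "Q \<in> J" for Q
    using assms that by (auto elim!: cubesE)
  then show ?thesis
    unfolding sharp_max_def oscillation_def poly_error_def
    by (intro SUP_cong) (auto simp: set_lebesgue_integral_lebesgue_on)
qed

lemma cube_subset_enlarged_cube:
  fixes a :: "real ^ 'n::finite"
  assumes "e > 0"
  shows "cbox a (\<chi> i. a $ i + s) \<subseteq> box (\<chi> i. a $ i - e) (\<chi> i. (\<chi> i. a $ i - e) $ i + (s + 2 * e))"
proof
  fix x assume x: "x \<in> cbox a (\<chi> i. a $ i + s)"
  have "a $ i - e < x $ i \<and> x $ i < a $ i - e + (s + 2 * e)" for i
  proof -
    have "a $ i \<le> x $ i \<and> x $ i \<le> a $ i + s" using x by (simp add: mem_box_cart)
    then show ?thesis using assms by linarith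
  qed
  then show "x \<in> box (\<chi> i. a $ i - e) (\<chi> i. (\<chi> i. a $ i - e) $ i + (s + 2 * e))"
    by (simp add: mem_box_cart)
qed

text \<open>A cube may be enlarged slightly so that the given point becomes an interior point; the error
  can only grow, and the normalising factors change continuously. Hence the maximal function is
  lower semicontinuous.\<close>

lemma open_sharp_max_cubes_greater:
  fixes g :: "real ^ 'n::finite \<Rightarrow> real"
  assumes g: "locally_square_integrable g"
  shows "open {x. y < sharp_max \<alpha> cubes g x}"
proof (subst open_subopen, rule ballI)
  fix x assume "x \<in> {x. y < sharp_max \<alpha> cubes g x}"
  then obtain Q where Q: "Q \<in> cubes" "x \<in> Q" "y < ennreal (oscillation \<alpha> Q g)"
    by (auto simp: sharp_max_eq_SUP_oscillation less_SUP_iff)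
  obtain a s where s: "s > 0" "Q = cbox a (\<chi> i. a $ i + s)"
    using Q(1) by (rule cubesE)
  define E where "E = poly_error \<alpha> Q g"
  have "((\<lambda>e. (s + 2 * e) powr (- \<alpha>) * sqrt (E / (s + 2 * e) ^ CARD('n))) \<longlongrightarrow>
      (s + 2 * 0) powr (- \<alpha>) * sqrt (E / (s + 2 * 0) ^ CARD('n))) (at_right 0)"
    using s(1) by (intro tendsto_intros) auto
  then have "((\<lambda>e. ennreal ((s + 2 * e) powr (- \<alpha>) * sqrt (E / (s + 2 * e) ^ CARD('n)))) \<longlongrightarrow>
      ennreal (oscillation \<alpha> Q g)) (at_right 0)"
    using oscillation_cube[OF s(1), of \<alpha> a g] by (intro tendsto_ennrealI) (simp add: s(2) E_def)
  then have "\<forall>\<^sub>F e in at_right 0. y < ennreal ((s + 2 * e) powr (- \<alpha>) * sqrt (E / (s + 2 * e) ^ CARD('n)))"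
    using Q(3) by (rule order_tendstoD)
  moreover have "\<forall>\<^sub>F e in at_right 0. (0::real) < e"
    by (rule eventually_at_right_less)
  ultimately have "\<forall>\<^sub>F e in at_right 0. (0::real) < e \<and> 
      y < ennreal ((s + 2 * e) powr (- \<alpha>) * sqrt (E / (s + 2 * e) ^ CARD('n)))"
    by eventually_elim simp
  then obtain e where e: "e > 0"
      "y < ennreal ((s + 2 * e) powr (- \<alpha>) * sqrt (E / (s + 2 * e) ^ CARD('n)))"
    by (metis (no_types, lifting) eventually_happens' trivial_limit_at_right_real)
  define a' where "a' = (\<chi> i. a $ i - e)"
  define b' where "b' = (\<chi> i. a' $ i + (s + 2 * e))"
  have s': "s + 2 * e > 0" using s e by simp
  have Q_sub: "Q \<subseteq> box a' b'"
    unfolding a'_def b'_def s(2) by (rule cube_subset_enlarged_cube[OF e(1)])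
  have "E \<le> poly_error \<alpha> (cbox a' b') g"
    unfolding E_def s(2)
    using Q_sub box_subset_cbox[of a' b'] unfolding s(2)
    by (intro poly_error_mono locally_square_integrable_on_cbox g box_cube_nonempty s(1)) blast
  then have "y < ennreal (oscillation \<alpha> (cbox a' b') g)"
    unfolding b'_def oscillation_cube[OF s'] using s'
    by (intro less_le_trans[OF e(2)] ennreal_leI mult_left_mono real_sqrt_le_mono divide_right_mono) auto
  moreover have "cbox a' b' \<in> cubes"
    unfolding b'_def by (rule cubesI[OF s']) simp
  ultimately have "box a' b' \<subseteq> {x. y < sharp_max \<alpha> cubes g x}"
    using box_subset_cbox[of a' b'] by (auto simp: sharp_max_eq_SUP_oscillation less_SUP_iff)
  moreover have "x \<in> box a' b'" using Q_sub Q(2) by blast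
  ultimately show "\<exists>T. open T \<and> x \<in> T \<and> T \<subseteq> {x. y < sharp_max \<alpha> cubes g x}"
    using open_box by blast
qed

text \<open>Measurability is essential here, since the essential supremum of a non-measurable function is
  infinite by convention.\<close>

lemma borel_measurable_sharp_max_cubes:
  assumes "locally_square_integrable g"
  shows "sharp_max \<alpha> cubes g \<in> borel_measurable lebesgue"
  using open_sharp_max_cubes_greater[OF assms]
  by (intro borel_measurableI_greater) (auto intro!: lmeasurable_open sets_completionI_sets)

lemma countable_dyadic_cubes: "countable (dyadic_cubes :: (real ^ 'n::finite) set set)"
proof (rule countable_subset)
  show "(dyadic_cubes :: (real ^ 'n) set set) \<subseteq>
      (\<lambda>(n, k). cbox (\<chi> i. (of_int (k i) - 1) * 2 powi n) (\<chi> i. of_int (k i) * 2 powi n)) ` UNIV"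
    by (auto simp: dyadic_cubes_def)
qed simp

lemma dyadic_cubesI:
  fixes k :: "'n::finite \<Rightarrow> int"
  assumes "a = (\<chi> i. (of_int (k i) - 1) * 2 powi n)"
  shows "cbox a (\<chi> i. a $ i + 2 powi n) \<in> dyadic_cubes"
proof -
  have "cbox a (\<chi> i. a $ i + 2 powi n) =
      cbox (\<chi> i. (of_int (k i) - 1) * 2 powi n) (\<chi> i. of_int (k i) * 2 powi n)"
    by (simp add: assms algebra_simps)
  then show ?thesis unfolding dyadic_cubes_def by blast
qed

lemma dyadic_cubes_subset_cubes: "dyadic_cubes \<subseteq> cubes"
proof
  fix Q :: "(real ^ 'n) set" assume "Q \<in> dyadic_cubes"
  then obtain n and k :: "'n \<Rightarrow> int"
    where Q: "Q = cbox (\<chi> i. (of_int (k i) - 1) * 2 powi n) (\<chi> i. of_int (k i) * 2 powi n)"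
    by (auto simp: dyadic_cubes_def)
  show "Q \<in> cubes"
    by (rule cubesI[of "2 powi n" _ "\<chi> i. (of_int (k i) - 1) * 2 powi n"]) (simp_all add: Q algebra_simps)
qed

lemma borel_measurable_sharp_max_dyadic: "sharp_max \<alpha> dyadic_cubes g \<in> borel_measurable lebesgue"
proof (rule borel_measurableI_greater)
  fix y
  have "{x \<in> space lebesgue. y < sharp_max \<alpha> dyadic_cubes g x} =
      (\<Union>Q\<in>{Q\<in>dyadic_cubes. y < ennreal (oscillation \<alpha> Q g)}. Q)"
    by (auto simp: sharp_max_eq_SUP_oscillation[OF dyadic_cubes_subset_cubes] less_SUP_iff)
  also have "\<dots> \<in> sets lebesgue"
    by (intro sets.countable_UN' countable_subset[OF _ countable_dyadic_cubes])
      (auto simp: dyadic_cubes_def)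
  finally show "{x \<in> space lebesgue. y < sharp_max \<alpha> dyadic_cubes g x} \<in> sets lebesgue" .
qed

text \<open>The maximal function is at least the oscillation of \<open>Q\<close> at every point of \<open>Q\<close>, hence on a set of
  positive measure; therefore the essential supremum sees every cube.\<close>

lemma lip_norm_eq_SUP_oscillation:
  fixes g :: "real ^ 'n::finite \<Rightarrow> real"
  assumes J: "J \<subseteq> cubes" and meas: "sharp_max \<alpha> J g \<in> borel_measurable lebesgue"
  shows "lip_norm \<alpha> J g = (SUP Q\<in>J. ennreal (oscillation \<alpha> Q g))"
proof (rule antisym)
  have "sharp_max \<alpha> J g x \<le> (SUP Q\<in>J. ennreal (oscillation \<alpha> Q g))" for x
    unfolding sharp_max_eq_SUP_oscillation[OF J] by (rule SUP_subset_mono) auto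
  then show "lip_norm \<alpha> J g \<le> (SUP Q\<in>J. ennreal (oscillation \<alpha> Q g))"
    unfolding lip_norm_def by (intro esssup_I meas) simp
next
  show "(SUP Q\<in>J. ennreal (oscillation \<alpha> Q g)) \<le> lip_norm \<alpha> J g"
  proof (rule SUP_least)
    fix Q assume "Q \<in> J"
    then have "Q \<in> cubes" using J by blast
    then obtain a s where s: "s > 0" "Q = cbox a (\<chi> i. a $ i + s)"
      by (rule cubesE)
    have lower: "ennreal (oscillation \<alpha> Q g) \<le> sharp_max \<alpha> J g x" if "x \<in> Q" for x
      unfolding sharp_max_eq_SUP_oscillation[OF J] using \<open>Q \<in> J\<close> that by (intro SUP_upper) simp
    show "ennreal (oscillation \<alpha> Q g) \<le> lip_norm \<alpha> J g"
    proof (rule ccontr)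
      assume "\<not> ennreal (oscillation \<alpha> Q g) \<le> lip_norm \<alpha> J g"
      then have "AE x in lebesgue. x \<notin> Q"
        using esssup_AE[of "sharp_max \<alpha> J g" lebesgue] lower
        by (auto simp: lip_norm_def elim!: eventually_mono dest: order.trans)
      then have "Q \<in> null_sets lebesgue"
        by (simp add: s(2) AE_iff_null_sets)
      then have "measure lebesgue Q = 0"
        by (simp add: measure_def null_sets_def)
      then show False using measure_cube[OF s(1), of a] s by simp
    qed
  qed
qed

lemma lip_norm_cubes:
  "locally_square_integrable g \<Longrightarrow> lip_norm \<alpha> cubes g = (SUP Q\<in>cubes. ennreal (oscillation \<alpha> Q g))"
  by (intro lip_norm_eq_SUP_oscillation borel_measurable_sharp_max_cubes) auto

lemma lip_norm_dyadic:
  "lip_norm \<alpha> dyadic_cubes g = (SUP Q\<in>dyadic_cubes. ennreal (oscillation \<alpha> Q g))"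
  by (intro lip_norm_eq_SUP_oscillation borel_measurable_sharp_max_dyadic dyadic_cubes_subset_cubes)

section \<open>The dyadic subdivision of \<open>[-1,1]\<^sup>N\<close>\<close>

lemma Q0_subcubesE:
  assumes "J \<in> Q0_subcubes"
  obtains a where "\<forall>i. a $ i \<in> {-1, 0}" "J = cbox a (\<chi> i. a $ i + 1)"
  using assms by (auto simp: Q0_subcubes_def)

lemma finite_Q0_subcubes: "finite (Q0_subcubes :: (real ^ 'n::finite) set set)"
proof (rule finite_subset)
  let ?c = "\<lambda>b :: 'n \<Rightarrow> bool. (\<chi> i. if b i then 0 else - 1) :: real ^ 'n"
  show "Q0_subcubes \<subseteq> (\<lambda>b. cbox (?c b) (\<chi> i. ?c b $ i + 1)) ` UNIV"
  proof
    fix J :: "(real ^ 'n) set" assume "J \<in> Q0_subcubes"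
    then obtain a where a: "\<forall>i. a $ i \<in> {-1, 0}" "J = cbox a (\<chi> i. a $ i + 1)"
      by (rule Q0_subcubesE)
    have "a = ?c (\<lambda>i. a $ i = 0)" using a(1) by (auto simp: vec_eq_iff)
    then show "J \<in> (\<lambda>b. cbox (?c b) (\<chi> i. ?c b $ i + 1)) ` UNIV"
      by (intro image_eqI[of _ _ "\<lambda>i. a $ i = 0"]) (simp_all only: a(2) UNIV_I)
  qed
qed simp

lemma Q0_subcube_subset:
  assumes "J \<in> Q0_subcubes"
  shows "J \<subseteq> Q0"
proof
  fix x assume x: "x \<in> J"
  obtain a where a: "\<forall>i. a $ i \<in> {-1, 0}" "J = cbox a (\<chi> i. a $ i + 1)"
    using assms by (rule Q0_subcubesE)
  have "- 1 \<le> x $ i \<and> x $ i \<le> 1" for i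
  proof -
    have "a $ i \<le> x $ i \<and> x $ i \<le> a $ i + 1" using x a by (auto simp: mem_box_cart)
    then show ?thesis using a(1)[rule_format, of i] by auto
  qed
  then show "x \<in> Q0" by (simp add: Q0_def mem_box_cart)
qed

lemma AE_coordinates_nonzero: "AE x :: real ^ 'n::finite in lebesgue. \<forall>i. x $ i \<noteq> 0"
proof -
  have "AE x in lebesgue. (x :: real ^ 'n) $ i \<noteq> 0" for i
  proof (rule AE_I')
    have "negligible {x :: real ^ 'n. axis i 1 \<bullet> x = 0}"
      by (rule negligible_hyperplane) (simp add: axis_eq_0_iff)
    then show "{x :: real ^ 'n. x $ i = 0} \<in> null_sets lebesgue"
      by (simp add: negligible_iff_null_sets inner_axis inner_commute)
  qed auto
  then show ?thesis by (simp add: AE_all_countable)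
qed

text \<open>A point without zero coordinates lies in the subcube given by the signs of its coordinates, and
  in no other.\<close>

lemma AE_in_unique_Q0_subcube:
  "AE x in lebesgue. x \<in> Q0 \<longrightarrow>
    (\<exists>J0\<in>Q0_subcubes. \<forall>J\<in>Q0_subcubes. (x :: real ^ 'n::finite) \<in> J \<longleftrightarrow> J = J0)"
  using AE_coordinates_nonzero
proof eventually_elim
  case (elim x)
  show ?case
  proof
    assume "x \<in> Q0"
    then have x: "- 1 \<le> x $ i" "x $ i \<le> 1" for i by (simp_all add: Q0_def mem_box_cart)
    define c :: "real ^ 'n" where "c = (\<chi> i. if x $ i < 0 then - 1 else 0)"
    have "x \<in> cbox c (\<chi> i. c $ i + 1)"
      using x elim by (auto simp: c_def mem_box_cart)
    moreover have "cbox c (\<chi> i. c $ i + 1) \<in> Q0_subcubes"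
      unfolding Q0_subcubes_def by (rule CollectI, rule exI[of _ c]) (auto simp: c_def)
    moreover have "J = cbox c (\<chi> i. c $ i + 1)" if J: "J \<in> Q0_subcubes" "x \<in> J" for J
    proof -
      obtain a where a: "\<forall>i. a $ i \<in> {-1, 0}" "J = cbox a (\<chi> i. a $ i + 1)"
        using J(1) by (rule Q0_subcubesE)
      have "a $ i = c $ i" for i
      proof -
        have "a $ i \<le> x $ i \<and> x $ i \<le> a $ i + 1" using J a by (auto simp: mem_box_cart)
        then show ?thesis using a(1)[rule_format, of i] elim[rule_format, of i] by (auto simp: c_def)
      qed
      then have "a = c" by (simp add: vec_eq_iff)
      then show ?thesis using a(2) by simp
    qed
    ultimately show "\<exists>J0\<in>Q0_subcubes. \<forall>J\<in>Q0_subcubes. x \<in> J \<longleftrightarrow> J = J0" by blast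
  qed
qed

text \<open>Functions given on each subcube are glued by adding them up; the overlaps are null sets.\<close>

lemma AE_sum_Q0_subcubes:
  fixes F :: "(real ^ 'n::finite) set \<Rightarrow> real ^ 'n \<Rightarrow> real"
  shows "AE x in lebesgue. \<forall>J\<in>Q0_subcubes. x \<in> J \<longrightarrow>
    (\<Sum>I\<in>Q0_subcubes. indicator I x * F I x) = F J x"
  using AE_in_unique_Q0_subcube
proof eventually_elim
  case (elim x)
  show ?case
  proof (intro ballI impI)
    fix J assume J: "J \<in> Q0_subcubes" "x \<in> J"
    then obtain J0 where "\<forall>I\<in>Q0_subcubes. x \<in> I \<longleftrightarrow> I = J0"
      using elim Q0_subcube_subset[OF J(1)] by (meson subsetD)
    then have uniq: "x \<in> I \<longleftrightarrow> I = J" if "I \<in> Q0_subcubes" for I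
      using J that by simp
    have "(\<Sum>I\<in>Q0_subcubes. indicator I x * F I x) = (\<Sum>I\<in>Q0_subcubes. if I = J then F I x else 0)"
      by (intro sum.cong) (auto simp: uniq)
    then show "(\<Sum>I\<in>Q0_subcubes. indicator I x * F I x) = F J x"
      using J by (simp add: finite_Q0_subcubes)
  qed
qed

lemma Q0_subcube_lebesgue: "J \<in> Q0_subcubes \<Longrightarrow> J \<in> sets lebesgue"
  by (auto elim!: Q0_subcubesE)

lemma Q0_lebesgue: "Q0 \<in> sets lebesgue"
  by (simp add: Q0_def)

lemma integrable_Q0_subcube:
  fixes f :: "real ^ 'n::finite \<Rightarrow> real"
  assumes "integrable (lebesgue_on Q0) f" "J \<in> Q0_subcubes"
  shows "integrable (lebesgue_on J) f"
  using assms set_integrable_subset[of lebesgue Q0 f J] Q0_subcube_subset[of J]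
    Q0_subcube_lebesgue[of J]
  by (simp add: integrable_restrict_space set_integrable_def Q0_lebesgue)

lemma integral_Q0_eq_sum:
  fixes f :: "real ^ 'n::finite \<Rightarrow> real"
  assumes "integrable (lebesgue_on Q0) f"
  shows "(\<integral>x. f x \<partial>lebesgue_on Q0) = (\<Sum>J\<in>Q0_subcubes. \<integral>x. f x \<partial>lebesgue_on J)"
proof -
  have int: "integrable lebesgue (\<lambda>x. indicator J x * f x)" if "J \<in> Q0_subcubes" for J
    using integrable_Q0_subcube[OF assms that] Q0_subcube_lebesgue[OF that]
    by (simp add: integrable_restrict_space)
  have "(\<integral>x. f x \<partial>lebesgue_on Q0) = (\<integral>x. indicator Q0 x * f x \<partial>lebesgue)"
    by (simp add: integral_restrict_space Q0_lebesgue)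
  also have "\<dots> = (\<integral>x. (\<Sum>J\<in>Q0_subcubes. indicator J x * f x) \<partial>lebesgue)"
  proof (rule integral_cong_AE)
    show "(\<lambda>x. indicator Q0 x * f x) \<in> borel_measurable lebesgue"
      using assms by (auto simp: integrable_restrict_space Q0_lebesgue)
    show "(\<lambda>x. \<Sum>J\<in>Q0_subcubes. indicator J x * f x) \<in> borel_measurable lebesgue"
      using int by auto
    show "AE x in lebesgue. indicator Q0 x * f x = (\<Sum>J\<in>Q0_subcubes. indicator J x * f x)"
      using AE_sum_Q0_subcubes[of "\<lambda>_. f"] AE_in_unique_Q0_subcube
    proof eventually_elim
      case (elim x)
      show ?case
      proof (cases "x \<in> Q0")
        case True
        then obtain J where "J \<in> Q0_subcubes" "x \<in> J" using elim(2) by blast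
        then have "(\<Sum>J\<in>Q0_subcubes. indicator J x * f x) = f x" using elim(1) by blast
        then show ?thesis using True by simp
      next
        case False
        then have "x \<notin> J" if "J \<in> Q0_subcubes" for J using Q0_subcube_subset[OF that] by blast
        then show ?thesis using False by (simp add: sum.neutral)
      qed
    qed
  qed
  also have "\<dots> = (\<Sum>J\<in>Q0_subcubes. \<integral>x. indicator J x * f x \<partial>lebesgue)"
    by (intro Bochner_Integration.integral_sum int)
  also have "\<dots> = (\<Sum>J\<in>Q0_subcubes. \<integral>x. f x \<partial>lebesgue_on J)"
    by (intro sum.cong) (auto simp: integral_restrict_space Q0_subcube_lebesgue)
  finally show ?thesis .
qed

section \<open>Piecewise polynomials and the error on \<open>[-1,1]\<^sup>N\<close>\<close>

abbreviation L2_Q0 :: "(real ^ 'n::finite \<Rightarrow> real) \<Rightarrow> bool"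
  where "L2_Q0 \<equiv> square_integrable (lebesgue_on Q0)"

lemma Q0_cbox: "Q0 = cbox (\<chi> i. -1) (\<chi> i. (\<chi> i. -1) $ i + 2)"
  by (simp add: Q0_def)

lemma proj_poly_Q0:
  fixes G :: "real ^ 'n::finite \<Rightarrow> real"
  assumes "L2_Q0 G"
  shows proj_poly_Q0_in_polys: "proj_poly \<alpha> Q0 G \<in> polys (intpart \<alpha>)"
    and proj_poly_Q0_orthogonal: "q \<in> polys (intpart \<alpha>) \<Longrightarrow>
      (\<integral>x. (G x - proj_poly \<alpha> Q0 G x) * q x \<partial>lebesgue_on Q0) = 0"
  using proj_poly_cbox[of "\<chi> i. -1" _ G] assms box_cube_nonempty[of 2 "\<chi> i. -1"]
  unfolding Q0_cbox by simp_all

lemma polys_L2_Q0: "q \<in> polys d \<Longrightarrow> L2_Q0 q"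
  unfolding Q0_def by (rule polys_square_integrable)

lemma L2_Q0_subcube:
  assumes "L2_Q0 f" "J \<in> Q0_subcubes"
  shows "square_integrable (lebesgue_on J) f"
proof -
  have "f \<in> borel_measurable (lebesgue_on J)"
    using assms(1) Q0_subcube_subset[OF assms(2)]
    by (auto simp: square_integrable_def intro: measurable_restrict_mono)
  then show ?thesis
    using assms integrable_Q0_subcube[of "\<lambda>x. (f x)\<^sup>2" J] by (simp add: square_integrable_def)
qed

lemma proj_poly_Q0_subcube:
  assumes "L2_Q0 G" "J \<in> Q0_subcubes"
  shows proj_poly_Q0_subcube_in_polys: "proj_poly \<alpha> J G \<in> polys (intpart \<alpha>)"
    and proj_poly_Q0_subcube_orthogonal: "q \<in> polys (intpart \<alpha>) \<Longrightarrow>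
      (\<integral>x. (G x - proj_poly \<alpha> J G x) * q x \<partial>lebesgue_on J) = 0"
proof -
  obtain a where a: "\<forall>i. a $ i \<in> {-1, 0}" "J = cbox a (\<chi> i. a $ i + 1)"
    using assms(2) by (rule Q0_subcubesE)
  note * = proj_poly_cbox[OF L2_Q0_subcube[OF assms, unfolded a(2)] box_cube_nonempty]
  show "proj_poly \<alpha> J G \<in> polys (intpart \<alpha>)"
    "q \<in> polys (intpart \<alpha>) \<Longrightarrow> (\<integral>x. (G x - proj_poly \<alpha> J G x) * q x \<partial>lebesgue_on J) = 0"
    unfolding a(2) using * by simp_all
qed

definition piecewise_poly :: "nat \<Rightarrow> (real ^ 'n::finite \<Rightarrow> real) \<Rightarrow> bool"
  where "piecewise_poly m r \<longleftrightarrow>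
    (\<forall>J\<in>Q0_subcubes. \<exists>q\<in>polys m. AE x in lebesgue. x \<in> J \<longrightarrow> r x = q x)"

text \<open>On the faces shared by several subcubes the summands add up, so this is the projection of \<open>G\<close>
  onto piecewise polynomials only almost everywhere.\<close>

definition piecewise_proj :: "real \<Rightarrow> (real ^ 'n::finite \<Rightarrow> real) \<Rightarrow> real ^ 'n \<Rightarrow> real"
  where "piecewise_proj \<alpha> G x = (\<Sum>J\<in>Q0_subcubes. indicator J x * proj_poly \<alpha> J G x)"

lemma AE_piecewise_proj:
  "AE x in lebesgue. \<forall>J\<in>Q0_subcubes. x \<in> J \<longrightarrow> piecewise_proj \<alpha> G x = proj_poly \<alpha> J G x"
  unfolding piecewise_proj_def by (rule AE_sum_Q0_subcubes)

lemma integral_subcube_cong: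
  fixes f h :: "real ^ 'n::finite \<Rightarrow> real"
  assumes "J \<in> Q0_subcubes" "f \<in> borel_measurable (lebesgue_on J)" "h \<in> borel_measurable (lebesgue_on J)"
    and "AE x in lebesgue. x \<in> J \<longrightarrow> f x = h x"
  shows "(\<integral>x. f x \<partial>lebesgue_on J) = (\<integral>x. h x \<partial>lebesgue_on J)"
  using assms by (intro integral_cong_AE) (simp_all add: AE_restrict_space_iff Q0_subcube_lebesgue)

lemma piecewise_proj_L2:
  fixes G :: "real ^ 'n::finite \<Rightarrow> real"
  assumes "L2_Q0 G"
  shows "L2_Q0 (piecewise_proj \<alpha> G)"
proof -
  have "L2_Q0 (\<lambda>x. indicator J x * proj_poly \<alpha> J G x)" if J: "J \<in> Q0_subcubes" for J
  proof -
    have q: "L2_Q0 (proj_poly \<alpha> J G)"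
      by (rule polys_L2_Q0[OF proj_poly_Q0_subcube_in_polys[OF assms J]])
    have m: "(indicator J :: _ \<Rightarrow> real) \<in> borel_measurable (lebesgue_on Q0)"
      by (intro measurable_restrict_space1 borel_measurable_indicator Q0_subcube_lebesgue J)
    have "(\<lambda>x. indicator J x * proj_poly \<alpha> J G x) \<in> borel_measurable (lebesgue_on Q0)"
      using q m by (auto simp: square_integrable_def)
    moreover from this have "integrable (lebesgue_on Q0) (\<lambda>x. (indicator J x * proj_poly \<alpha> J G x)\<^sup>2)"
      using q unfolding square_integrable_def
      by (elim conjE Bochner_Integration.integrable_bound) (auto simp: indicator_def)
    ultimately show ?thesis by (simp add: square_integrable_def)
  qed
  then show ?thesis unfolding piecewise_proj_def by (intro square_integrable_sum)
qed

text \<open>On each subcube \<open>G\<close> minus its approximating polynomial is orthogonal to polynomials, and \<open>r\<close> is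
  one there.\<close>

lemma piecewise_proj_orthogonal:
  fixes G :: "real ^ 'n::finite \<Rightarrow> real"
  assumes G: "L2_Q0 G" and r: "L2_Q0 r" and piecewise: "piecewise_poly (intpart \<alpha>) r"
  shows "(\<integral>x. (G x - piecewise_proj \<alpha> G x) * r x \<partial>lebesgue_on Q0) = 0"
proof -
  let ?F = "piecewise_proj \<alpha> G"
  have GF: "L2_Q0 (\<lambda>x. G x - ?F x)"
    by (intro square_integrable_diff G piecewise_proj_L2)
  have "(\<integral>x. (G x - ?F x) * r x \<partial>lebesgue_on J) = 0" if J: "J \<in> Q0_subcubes" for J
  proof -
    obtain q where q: "q \<in> polys (intpart \<alpha>)" "AE x in lebesgue. x \<in> J \<longrightarrow> r x = q x"
      using piecewise J by (auto simp: piecewise_poly_def)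
    have Gq: "square_integrable (lebesgue_on J) (\<lambda>x. G x - proj_poly \<alpha> J G x)"
      by (rule L2_Q0_subcube[OF square_integrable_diff[OF G
        polys_L2_Q0[OF proj_poly_Q0_subcube_in_polys[OF G J]]] J])
    have "(\<integral>x. (G x - ?F x) * r x \<partial>lebesgue_on J) =
        (\<integral>x. (G x - proj_poly \<alpha> J G x) * q x \<partial>lebesgue_on J)"
    proof (rule integral_subcube_cong[OF J])
      show "(\<lambda>x. (G x - ?F x) * r x) \<in> borel_measurable (lebesgue_on J)"
        "(\<lambda>x. (G x - proj_poly \<alpha> J G x) * q x) \<in> borel_measurable (lebesgue_on J)"
        using square_integrable_mult[OF L2_Q0_subcube[OF GF J] L2_Q0_subcube[OF r J]]
          square_integrable_mult[OF Gq L2_Q0_subcube[OF polys_L2_Q0[OF q(1)] J]]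
        by (auto dest: borel_measurable_integrable)
      show "AE x in lebesgue. x \<in> J \<longrightarrow> (G x - ?F x) * r x = (G x - proj_poly \<alpha> J G x) * q x"
        using q(2) AE_piecewise_proj[of \<alpha> G] by eventually_elim (use J in auto)
    qed
    also have "\<dots> = 0" by (rule proj_poly_Q0_subcube_orthogonal[OF G J q(1)])
    finally show ?thesis .
  qed
  then show ?thesis
    by (subst integral_Q0_eq_sum[OF square_integrable_mult[OF GF r]]) simp
qed

lemma integral_piecewise_proj_error:
  fixes G :: "real ^ 'n::finite \<Rightarrow> real"
  assumes G: "L2_Q0 G"
  shows "(\<integral>x. (G x - piecewise_proj \<alpha> G x)\<^sup>2 \<partial>lebesgue_on Q0) = (\<Sum>J\<in>Q0_subcubes. poly_error \<alpha> J G)"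
proof -
  let ?F = "piecewise_proj \<alpha> G"
  have GF: "L2_Q0 (\<lambda>x. G x - ?F x)"
    by (intro square_integrable_diff G piecewise_proj_L2)
  have "(\<integral>x. (G x - ?F x)\<^sup>2 \<partial>lebesgue_on J) = poly_error \<alpha> J G" if J: "J \<in> Q0_subcubes" for J
    unfolding poly_error_def
  proof (rule integral_subcube_cong[OF J])
    have "square_integrable (lebesgue_on J) (\<lambda>x. G x - proj_poly \<alpha> J G x)"
      by (rule L2_Q0_subcube[OF square_integrable_diff[OF G
        polys_L2_Q0[OF proj_poly_Q0_subcube_in_polys[OF G J]]] J])
    then show "(\<lambda>x. (G x - ?F x)\<^sup>2) \<in> borel_measurable (lebesgue_on J)"
      "(\<lambda>x. (G x - proj_poly \<alpha> J G x)\<^sup>2) \<in> borel_measurable (lebesgue_on J)"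
      using L2_Q0_subcube[OF GF J] by (auto simp: square_integrable_def)
    show "AE x in lebesgue. x \<in> J \<longrightarrow> (G x - ?F x)\<^sup>2 = (G x - proj_poly \<alpha> J G x)\<^sup>2"
      using AE_piecewise_proj[of \<alpha> G] by eventually_elim (use J in auto)
  qed
  then show ?thesis
    using GF by (subst integral_Q0_eq_sum) (auto simp: square_integrable_def)
qed

lemma A_space_integral_mult_poly:
  fixes f :: "real ^ 'n::finite \<Rightarrow> real"
  assumes f: "f \<in> A_space \<alpha>" "L2_Q0 f" and q: "q \<in> polys (intpart \<alpha>)"
  shows "(\<integral>x. f x * q x \<partial>lebesgue_on Q0) = 0"
proof -
  have "(\<lambda>x. f x * indicator Q0 x) = f"
    using f(1) by (auto simp: A_space_def indicator_def fun_eq_iff)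
  then have "vanishing_moments (intpart \<alpha>) (\<lambda>x. f x * indicator Q0 x)"
    using f(1) by (simp add: A_space_def)
  then show ?thesis
    using vanishing_moments_cbox_iff[OF f(2)[unfolded Q0_def]] q by (auto simp: Q0_def)
qed

text \<open>Both the piecewise projection and the projection on the whole cube differ from \<open>G\<close> by functions
  with vanishing moments on \<open>[-1,1]\<^sup>N\<close>; hence so does their difference, which is moreover a piecewise
  polynomial.\<close>

lemma piecewise_proj_diff_in_A_space:
  fixes G :: "real ^ 'n::finite \<Rightarrow> real" and \<alpha> :: real
  assumes G: "L2_Q0 G"
  defines "f \<equiv> \<lambda>x. (piecewise_proj \<alpha> G x - proj_poly \<alpha> Q0 G x) * indicator Q0 x"
  shows "f \<in> A_space \<alpha>"
proof -
  let ?F = "piecewise_proj \<alpha> G" and ?q = "proj_poly \<alpha> Q0 G"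
  have q: "?q \<in> polys (intpart \<alpha>)" by (rule proj_poly_Q0_in_polys[OF G])
  have F: "L2_Q0 ?F" by (rule piecewise_proj_L2[OF G])
  have GF: "L2_Q0 (\<lambda>x. G x - ?F x)" and Gq: "L2_Q0 (\<lambda>x. G x - ?q x)"
    and Fq: "L2_Q0 (\<lambda>x. ?F x - ?q x)"
    by (rule square_integrable_diff[OF G F] square_integrable_diff[OF G polys_L2_Q0[OF q]]
      square_integrable_diff[OF F polys_L2_Q0[OF q]])+
  have "(\<integral>x. (?F x - ?q x) * r x \<partial>lebesgue_on Q0) = 0" if r: "r \<in> polys (intpart \<alpha>)" for r
  proof -
    have "(\<integral>x. (?F x - ?q x) * r x \<partial>lebesgue_on Q0) =
        (\<integral>x. (G x - ?q x) * r x - (G x - ?F x) * r x \<partial>lebesgue_on Q0)"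
      by (simp add: algebra_simps)
    also have "\<dots> = (\<integral>x. (G x - ?q x) * r x \<partial>lebesgue_on Q0) - (\<integral>x. (G x - ?F x) * r x \<partial>lebesgue_on Q0)"
      by (intro Bochner_Integration.integral_diff square_integrable_mult Gq GF polys_L2_Q0[OF r])
    also have "\<dots> = 0"
      using proj_poly_Q0_orthogonal[OF G r] piecewise_proj_orthogonal[OF G polys_L2_Q0[OF r], of \<alpha>] r
      by (auto simp: piecewise_poly_def)
    finally show ?thesis .
  qed
  then have "vanishing_moments (intpart \<alpha>) f"
    using vanishing_moments_cbox_iff[OF Fq[unfolded Q0_def]] by (simp add: f_def Q0_def)
  moreover have "\<exists>r\<in>polys (intpart \<alpha>). AE x in lebesgue. x \<in> J \<longrightarrow> f x = r x" if J: "J \<in> Q0_subcubes" for J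
  proof (rule bexI)
    show "(\<lambda>x. proj_poly \<alpha> J G x - ?q x) \<in> polys (intpart \<alpha>)"
      by (intro polys_diff q proj_poly_Q0_subcube_in_polys G J)
    show "AE x in lebesgue. x \<in> J \<longrightarrow> f x = proj_poly \<alpha> J G x - ?q x"
      using AE_piecewise_proj[of \<alpha> G]
      by eventually_elim (use J Q0_subcube_subset[OF J] in \<open>auto simp: f_def indicator_def\<close>)
  qed
  ultimately show ?thesis by (auto simp: A_space_def f_def)
qed

context
  fixes \<alpha> :: real and M :: nat and p :: "nat \<Rightarrow> real ^ 'n::finite \<Rightarrow> real"
  assumes basis: "orthonormal_basis_A \<alpha> M p"
begin

lemma basis_in_A_space: "L \<in> {1..M} \<Longrightarrow> p L \<in> A_space \<alpha>"
  using basis by (simp add: orthonormal_basis_A_def)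

lemma basis_orthonormal:
  "L \<in> {1..M} \<Longrightarrow> L' \<in> {1..M} \<Longrightarrow>
    (\<integral>x. p L x * p L' x \<partial>lebesgue_on Q0) = (if L = L' then 1 else 0)"
  using basis set_lebesgue_integral_lebesgue_on[OF Q0_lebesgue, of "\<lambda>x. p L x * p L' x"]
  by (simp add: orthonormal_basis_A_def)

lemma basis_borel_measurable:
  assumes "L \<in> {1..M}"
  shows "p L \<in> borel_measurable lebesgue"
proof -
  have "has_bochner_integral lebesgue (\<lambda>x. p L x * mi_monom (\<lambda>_. 0) x) 0"
    using basis_in_A_space[OF assms] by (auto simp: A_space_def vanishing_moments_def multi_indices_def)
  then show ?thesis by (simp add: mi_monom_def has_bochner_integral_iff borel_measurable_integrable)
qed

lemma basis_L2:
  assumes "L \<in> {1..M}"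
  shows "L2_Q0 (p L)"
proof -
  \<comment> \<open>the integral of a function that is not integrable is \<open>0\<close> by convention, so the normalisation
    already contains square integrability\<close>
  have "(\<integral>x. (p L x)\<^sup>2 \<partial>lebesgue_on Q0) \<noteq> 0"
    using basis_orthonormal[OF assms assms] by (simp add: power2_eq_square)
  then have "integrable (lebesgue_on Q0) (\<lambda>x. (p L x)\<^sup>2)"
    using not_integrable_integral_eq by blast
  then show ?thesis
    using basis_borel_measurable[OF assms] by (simp add: square_integrable_def measurable_restrict_space1)
qed

lemma pairing_basis:
  assumes "L \<in> {1..M}"
  shows "pairing G (p L) = (\<integral>x. G x * p L x \<partial>lebesgue_on Q0)"
proof -
  have "(\<lambda>x. G x * p L x) = (\<lambda>x. indicator Q0 x * (G x * p L x))"
    using basis_in_A_space[OF assms] by (auto simp: A_space_def indicator_def fun_eq_iff)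
  then have "pairing G (p L) = (\<integral>x. indicator Q0 x * (G x * p L x) \<partial>lebesgue)"
    unfolding pairing_def by simp
  then show ?thesis by (simp add: integral_restrict_space Q0_lebesgue)
qed

lemma pairing_basis_eq:
  assumes G: "L2_Q0 G" and L: "L \<in> {1..M}" and q: "q \<in> polys (intpart \<alpha>)"
  shows "pairing G (p L) = (\<integral>x. (G x - q x) * p L x \<partial>lebesgue_on Q0)"
proof -
  have "(\<integral>x. (G x - q x) * p L x \<partial>lebesgue_on Q0) = (\<integral>x. G x * p L x - p L x * q x \<partial>lebesgue_on Q0)"
    by (simp add: algebra_simps)
  also have "\<dots> = (\<integral>x. G x * p L x \<partial>lebesgue_on Q0) - (\<integral>x. p L x * q x \<partial>lebesgue_on Q0)"
    by (intro Bochner_Integration.integral_diff square_integrable_mult G basis_L2[OF L] polys_L2_Q0[OF q])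
  also have "(\<integral>x. p L x * q x \<partial>lebesgue_on Q0) = 0"
    by (rule A_space_integral_mult_poly[OF basis_in_A_space[OF L] basis_L2[OF L] q])
  finally show ?thesis by (simp add: pairing_basis[OF L])
qed

lemma pairing_basis_square_le:
  assumes G: "L2_Q0 G" and L: "L \<in> {1..M}"
  shows "(pairing G (p L))\<^sup>2 \<le> poly_error \<alpha> Q0 G"
proof -
  let ?q = "proj_poly \<alpha> Q0 G"
  have q: "?q \<in> polys (intpart \<alpha>)" by (rule proj_poly_Q0_in_polys[OF G])
  have "(pairing G (p L))\<^sup>2 \<le> poly_error \<alpha> Q0 G * (\<integral>x. (p L x)\<^sup>2 \<partial>lebesgue_on Q0)"
    unfolding pairing_basis_eq[OF G L q] poly_error_def
    by (intro Cauchy_Schwarz_integral square_integrable_diff G polys_L2_Q0[OF q] basis_L2[OF L])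
  then show ?thesis using basis_orthonormal[OF L L] by (simp add: power2_eq_square)
qed

text \<open>Parseval's identity in \<open>A\<close>.\<close>

lemma integral_square_A_space:
  assumes f: "f \<in> A_space \<alpha>" "L2_Q0 f"
  shows "(\<integral>x. (f x)\<^sup>2 \<partial>lebesgue_on Q0) = (\<Sum>L\<in>{1..M}. (\<integral>x. f x * p L x \<partial>lebesgue_on Q0)\<^sup>2)"
proof -
  obtain c where c: "AE x in lebesgue. f x = (\<Sum>L\<in>{1..M}. c L * p L x)"
    using basis f(1) by (auto simp: orthonormal_basis_A_def)
  have expand: "(\<integral>x. f x * h x \<partial>lebesgue_on Q0) = (\<Sum>L\<in>{1..M}. c L * (\<integral>x. p L x * h x \<partial>lebesgue_on Q0))"
    if h: "L2_Q0 h" for h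
  proof -
    have i: "integrable (lebesgue_on Q0) (\<lambda>x. c L * (p L x * h x))" if "L \<in> {1..M}" for L
      using square_integrable_mult[OF basis_L2[OF that] h] by simp
    have "(\<integral>x. f x * h x \<partial>lebesgue_on Q0) = (\<integral>x. (\<Sum>L\<in>{1..M}. c L * (p L x * h x)) \<partial>lebesgue_on Q0)"
    proof (rule integral_cong_AE)
      show "(\<lambda>x. f x * h x) \<in> borel_measurable (lebesgue_on Q0)"
        using square_integrable_mult[OF f(2) h] by (rule borel_measurable_integrable)
      show "(\<lambda>x. \<Sum>L\<in>{1..M}. c L * (p L x * h x)) \<in> borel_measurable (lebesgue_on Q0)"
        using i by (intro borel_measurable_sum borel_measurable_integrable)
      show "AE x in lebesgue_on Q0. f x * h x = (\<Sum>L\<in>{1..M}. c L * (p L x * h x))"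
        using c by (auto simp: AE_restrict_space_iff Q0_lebesgue sum_distrib_right mult.assoc elim!: eventually_mono)
    qed
    also have "\<dots> = (\<Sum>L\<in>{1..M}. c L * (\<integral>x. p L x * h x \<partial>lebesgue_on Q0))"
      by (subst Bochner_Integration.integral_sum) (use i in auto)
    finally show ?thesis .
  qed
  have coeff: "(\<integral>x. f x * p L x \<partial>lebesgue_on Q0) = c L" if L: "L \<in> {1..M}" for L
  proof -
    have "(\<integral>x. f x * p L x \<partial>lebesgue_on Q0) = (\<Sum>L'\<in>{1..M}. if L' = L then c L' else 0)"
      unfolding expand[OF basis_L2[OF L]] using L by (intro sum.cong) (auto simp: basis_orthonormal)
    then show ?thesis using L by simp
  qed
  have "(\<integral>x. (f x)\<^sup>2 \<partial>lebesgue_on Q0) = (\<Sum>L\<in>{1..M}. c L * (\<integral>x. f x * p L x \<partial>lebesgue_on Q0))"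
    using expand[OF f(2)] by (simp add: power2_eq_square mult.commute)
  then show ?thesis by (simp add: coeff power2_eq_square)
qed

text \<open>The heart of the matter. Let \<open>F\<close> be the piecewise projection of \<open>G\<close> and \<open>q\<close> its projection on
  \<open>[-1,1]\<^sup>N\<close>, and split \<open>G - q = (G - F) + (F - q)\<close>. The first part is measured by the errors on the
  subcubes. The second lies in \<open>A\<close>, so Parseval gives its norm, and its coefficients are the
  pairings of \<open>G\<close> itself with the basis, because \<open>G - F\<close> is orthogonal to piecewise polynomials and
  \<open>q\<close> to \<open>A\<close>.\<close>

lemma poly_error_Q0_le:
  assumes G: "L2_Q0 G"
  shows "poly_error \<alpha> Q0 G \<le>
    2 * (\<Sum>J\<in>Q0_subcubes. poly_error \<alpha> J G) + 2 * (\<Sum>L\<in>{1..M}. (pairing G (p L))\<^sup>2)"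
proof -
  let ?F = "piecewise_proj \<alpha> G" and ?q = "proj_poly \<alpha> Q0 G" and ?M = "lebesgue_on Q0"
  define f where "f = (\<lambda>x. (?F x - ?q x) * indicator Q0 x)"
  have q: "?q \<in> polys (intpart \<alpha>)" by (rule proj_poly_Q0_in_polys[OF G])
  have F: "L2_Q0 ?F" by (rule piecewise_proj_L2[OF G])
  have GF: "L2_Q0 (\<lambda>x. G x - ?F x)" and Gq: "L2_Q0 (\<lambda>x. G x - ?q x)"
    and Fq: "L2_Q0 (\<lambda>x. ?F x - ?q x)"
    by (rule square_integrable_diff[OF G F] square_integrable_diff[OF G polys_L2_Q0[OF q]]
      square_integrable_diff[OF F polys_L2_Q0[OF q]])+
  have f_eq: "f x = ?F x - ?q x" if "x \<in> Q0" for x using that by (simp add: f_def)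
  have on_Q0: "(\<integral>x. h (f x) x \<partial>?M) = (\<integral>x. h (?F x - ?q x) x \<partial>?M)" for h :: "real \<Rightarrow> real ^ 'n \<Rightarrow> real"
    by (intro Bochner_Integration.integral_cong) (auto simp: f_eq)
  have f: "f \<in> A_space \<alpha>" 
    unfolding f_def by (rule piecewise_proj_diff_in_A_space[OF G])
  have f2: "L2_Q0 f"
  proof -
    have "f \<in> borel_measurable ?M \<longleftrightarrow> (\<lambda>x. ?F x - ?q x) \<in> borel_measurable ?M"
      by (intro measurable_cong) (auto simp: f_eq)
    moreover have "integrable ?M (\<lambda>x. (f x)\<^sup>2) \<longleftrightarrow> integrable ?M (\<lambda>x. (?F x - ?q x)\<^sup>2)"
      by (intro Bochner_Integration.integrable_cong) (auto simp: f_eq)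
    ultimately show ?thesis using Fq by (simp add: square_integrable_def)
  qed
  have coeff: "(\<integral>x. f x * p L x \<partial>?M) = pairing G (p L)" if L: "L \<in> {1..M}" for L
  proof -
    have "(\<integral>x. f x * p L x \<partial>?M) = (\<integral>x. (G x - ?q x) * p L x - (G x - ?F x) * p L x \<partial>?M)"
      using on_Q0[of "\<lambda>u x. u * p L x"] by (simp add: algebra_simps)
    also have "\<dots> = (\<integral>x. (G x - ?q x) * p L x \<partial>?M) - (\<integral>x. (G x - ?F x) * p L x \<partial>?M)"
      by (intro Bochner_Integration.integral_diff square_integrable_mult Gq GF basis_L2[OF L])
    also have "(\<integral>x. (G x - ?F x) * p L x \<partial>?M) = 0"
      using basis_in_A_space[OF L]
      by (intro piecewise_proj_orthogonal G basis_L2 L) (simp add: A_space_def piecewise_poly_def)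
    also have "(\<integral>x. (G x - ?q x) * p L x \<partial>?M) = pairing G (p L)"
      by (rule pairing_basis_eq[OF G L q, symmetric])
    finally show ?thesis by simp
  qed
  have "poly_error \<alpha> Q0 G \<le> (\<integral>x. 2 * (G x - ?F x)\<^sup>2 + 2 * (?F x - ?q x)\<^sup>2 \<partial>?M)"
    unfolding poly_error_def
  proof (rule integral_mono)
    show "integrable ?M (\<lambda>x. (G x - ?q x)\<^sup>2)"
      "integrable ?M (\<lambda>x. 2 * (G x - ?F x)\<^sup>2 + 2 * (?F x - ?q x)\<^sup>2)"
      using Gq GF Fq by (auto simp: square_integrable_def)
    have "(u + v)\<^sup>2 \<le> 2 * u\<^sup>2 + 2 * v\<^sup>2" for u v :: real
      using sum_squares_bound[of u v] by (simp add: power2_sum)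
    from this[of "G x - ?F x" "?F x - ?q x" for x]
    show "(G x - ?q x)\<^sup>2 \<le> 2 * (G x - ?F x)\<^sup>2 + 2 * (?F x - ?q x)\<^sup>2" for x
      by simp
  qed
  also have "\<dots> = 2 * (\<integral>x. (G x - ?F x)\<^sup>2 \<partial>?M) + 2 * (\<integral>x. (f x)\<^sup>2 \<partial>?M)"
    using GF Fq on_Q0[of "\<lambda>u x. u\<^sup>2"] by (simp add: square_integrable_def)
  also have "\<dots> = 2 * (\<Sum>J\<in>Q0_subcubes. poly_error \<alpha> J G) + 2 * (\<Sum>L\<in>{1..M}. (pairing G (p L))\<^sup>2)"
    by (simp add: integral_piecewise_proj_error[OF G] integral_square_A_space[OF f f2] coeff)
  finally show ?thesis .
qed

end

section \<open>Dilations and translations\<close>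

text \<open>The normalisation by \<open>|Q|\<^bsup>\<alpha>/N\<^esup>\<close> makes the oscillation homogeneous of degree \<open>- \<alpha>\<close> under
  dilations. This reduces every estimate on a dyadic copy of \<open>[-1,1]\<^sup>N\<close> to \<open>[-1,1]\<^sup>N\<close> itself.\<close>

lemma oscillation_affine:
  fixes g :: "real ^ 'n::finite \<Rightarrow> real"
  assumes g: "locally_square_integrable g" and s: "s > 0" and l: "l > 0"
  shows "oscillation \<alpha> (cbox (u + s *\<^sub>R a) (\<chi> i. (u + s *\<^sub>R a) $ i + s * l)) g =
    s powr (- \<alpha>) * oscillation \<alpha> (cbox a (\<chi> i. a $ i + l)) (\<lambda>y. g (u + s *\<^sub>R y))"
proof -
  let ?b = "\<chi> i. a $ i + l"
  have corner: "(\<chi> i. (u + s *\<^sub>R a) $ i + s * l) = u + s *\<^sub>R ?b"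
    by (simp add: vec_eq_iff algebra_simps)
  have "poly_error \<alpha> (cbox (u + s *\<^sub>R a) (\<chi> i. (u + s *\<^sub>R a) $ i + s * l)) g =
      s ^ CARD('n) * poly_error \<alpha> (cbox a ?b) (\<lambda>y. g (u + s *\<^sub>R y))"
    unfolding corner
    by (intro poly_error_affine s locally_square_integrable_on_cbox g box_cube_nonempty l)
  note error = this
  have sl: "s * l > 0" using s l by simp
  show ?thesis
    unfolding oscillation_cube[OF sl] oscillation_cube[OF l] error
    using s l by (simp add: powr_mult power_mult_distrib)
qed

lemma L2_Q0_affine:
  fixes g :: "real ^ 'n::finite \<Rightarrow> real"
  assumes g: "locally_square_integrable g" and s: "s > 0"
  shows "L2_Q0 (\<lambda>y. g (u + s *\<^sub>R y))"
  unfolding Q0_def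
  by (intro square_integrable_affine(1) s locally_square_integrable_on_cbox g)

text \<open>The map \<open>y \<mapsto> dyadic_shift m k + 2\<^sup>m y\<close> inverts \<open>x \<mapsto> 2\<^sup>n x + k\<close> for \<open>n = - m\<close>, so it carries
  \<open>[-1,1]\<^sup>N\<close> onto the cube supporting the members of the family with index \<open>(n, k)\<close>.\<close>

definition dyadic_shift :: "int \<Rightarrow> ('n::finite \<Rightarrow> int) \<Rightarrow> real ^ 'n"
  where "dyadic_shift m k = (\<chi> i. - (2 powi m) * of_int (k i))"

abbreviation dyadic_rescale :: "int \<Rightarrow> ('n::finite \<Rightarrow> int) \<Rightarrow> (real ^ 'n \<Rightarrow> real) \<Rightarrow> real ^ 'n \<Rightarrow> real"
  where "dyadic_rescale m k g \<equiv> \<lambda>y. g (dyadic_shift m k + (2 powi m) *\<^sub>R y)"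

text \<open>The factor \<open>2\<^bsup>n(N + \<alpha>)\<^esup>\<close> in the family is the one for which the pairings have the same
  homogeneity as the oscillations: \<open>2\<^bsup>nN\<^esup>\<close> cancels the Jacobian.\<close>

lemma pairing_S_family:
  fixes g h :: "real ^ 'n::finite \<Rightarrow> real"
  assumes g: "locally_square_integrable g" and h: "h \<in> borel_measurable lebesgue"
  shows "pairing g (\<lambda>x. 2 powr (of_int n * (real CARD('n) + \<alpha>)) * h (\<chi> i. 2 powi n * x $ i + of_int (k i))) =
    (2 powi (- n)) powr (- \<alpha>) * pairing (dyadic_rescale (- n) k g) h"
proof -
  define r :: real where "r = 2 powi n"
  have r: "r > 0" by (simp add: r_def)
  have r': "2 powi (- n) = inverse r" by (simp add: r_def power_int_minus)
  define t :: "real ^ 'n" where "t = (\<chi> i. of_int (k i))"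
  define G where "G = dyadic_rescale (- n) k g"
  have T: "(\<chi> i. 2 powi n * x $ i + of_int (k i)) = t + r *\<^sub>R x" for x
    by (simp add: vec_eq_iff t_def r_def)
  have G: "G (t + r *\<^sub>R x) = g x" for x
  proof -
    have "dyadic_shift (- n) k + (2 powi (- n)) *\<^sub>R (t + r *\<^sub>R x) = x"
      unfolding r' dyadic_shift_def using r by (simp add: vec_eq_iff t_def algebra_simps)
    then show ?thesis by (simp add: G_def)
  qed
  have meas: "G \<in> borel_measurable lebesgue"
    unfolding G_def r'
    by (rule measurable_compose[OF measurable_affine_cart])
      (use r g in \<open>auto simp: locally_square_integrable_def\<close>)
  have "pairing G h = r ^ CARD('n) * (\<integral>x. g x * h (t + r *\<^sub>R x) \<partial>lebesgue)"
    unfolding pairing_def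
    by (subst integral_affine_cart[OF r, of _ t]) (use meas h in \<open>auto simp: G\<close>)
  then have *: "(\<integral>x. g x * h (t + r *\<^sub>R x) \<partial>lebesgue) = pairing G h / r ^ CARD('n)"
    using r by simp
  have rpow: "r = 2 powr of_int n" by (simp add: r_def powr_real_of_int')
  have "2 powr (of_int n * (real CARD('n) + \<alpha>)) = r powr (real CARD('n) + \<alpha>)"
    by (simp add: rpow powr_powr)
  also have "\<dots> = r ^ CARD('n) * r powr \<alpha>"
    using r by (simp add: powr_add powr_realpow)
  finally have factor: "2 powr (of_int n * (real CARD('n) + \<alpha>)) = r ^ CARD('n) * inverse r powr (- \<alpha>)"
    using r by (simp add: inverse_powr powr_minus)
  have "pairing g (\<lambda>x. 2 powr (of_int n * (real CARD('n) + \<alpha>)) * h (\<chi> i. 2 powi n * x $ i + of_int (k i))) =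
      2 powr (of_int n * (real CARD('n) + \<alpha>)) * (\<integral>x. g x * h (t + r *\<^sub>R x) \<partial>lebesgue)"
  proof -
    have "(\<lambda>x. g x * (2 powr (of_int n * (real CARD('n) + \<alpha>)) * h (t + r *\<^sub>R x))) =
        (\<lambda>x. 2 powr (of_int n * (real CARD('n) + \<alpha>)) * (g x * h (t + r *\<^sub>R x)))"
      by (simp add: fun_eq_iff)
    then show ?thesis unfolding pairing_def T by simp
  qed
  also have "\<dots> = inverse r powr (- \<alpha>) * pairing G h"
    unfolding factor * using r by simp
  finally show ?thesis unfolding r' G_def .
qed

lemma dyadic_rescale_subcube_in_dyadic_cubes:
  fixes a :: "real ^ 'n::finite"
  assumes "\<forall>i. a $ i \<in> {-1, 0}"
  shows "cbox (dyadic_shift m k + (2 powi m) *\<^sub>R a)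
    (\<chi> i. (dyadic_shift m k + (2 powi m) *\<^sub>R a) $ i + 2 powi m) \<in> dyadic_cubes"
proof (rule dyadic_cubesI)
  have floor_corner: "of_int \<lfloor>a $ i\<rfloor> = a $ i" for i
    using assms[rule_format, of i] by (cases "a $ i = 0") simp_all
  show "dyadic_shift m k + (2 powi m) *\<^sub>R a = (\<chi> i. (of_int (\<lfloor>a $ i\<rfloor> - k i + 1) - 1) * 2 powi m)"
    by (simp add: vec_eq_iff dyadic_shift_def floor_corner algebra_simps)
qed

text \<open>The union of \<open>2\<^sup>N\<close> neighbouring dyadic cubes of side \<open>2\<^sup>m\<close>: the image of \<open>[-1,1]\<^sup>N\<close> under
  the rescaling, written as a lower corner and a side.\<close>

abbreviation dyadic_double_cube :: "int \<Rightarrow> ('n::finite \<Rightarrow> int) \<Rightarrow> (real ^ 'n) set"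
  where "dyadic_double_cube m k \<equiv> cbox (dyadic_shift m k + (2 powi m) *\<^sub>R (\<chi> i. -1))
    (\<chi> i. (dyadic_shift m k + (2 powi m) *\<^sub>R (\<chi> i. -1)) $ i + 2 powi m * 2)"

lemma oscillation_dyadic_double_cube:
  fixes g :: "real ^ 'n::finite \<Rightarrow> real"
  assumes "locally_square_integrable g"
  shows "oscillation \<alpha> (dyadic_double_cube m k) g = (2 powi m) powr (- \<alpha>) *
    (2 powr (- \<alpha>) * sqrt (poly_error \<alpha> Q0 (dyadic_rescale m k g) / 2 ^ CARD('n)))"
  using oscillation_affine[OF assms, of "2 powi m" 2 \<alpha> "dyadic_shift m k" "\<chi> i. -1"]
    oscillation_cube[of 2 \<alpha> "\<chi> i. -1" "dyadic_rescale m k g"]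
  by (simp add: Q0_def)

text \<open>An interval of length at most \<open>2\<^sup>m\<close> is covered by two consecutive dyadic intervals of length
  \<open>2\<^sup>m\<close>. Dyadic cubes themselves do not have this property: a cube around the origin lies
  in no dyadic cube, however large.\<close>

lemma cube_subset_dyadic_double_cube:
  fixes a :: "real ^ 'n::finite"
  assumes "l > 0"
  obtains m k where "l \<le> 2 powi m" "2 powi m \<le> 2 * l"
    "cbox a (\<chi> i. a $ i + l) \<subseteq> dyadic_double_cube m k"
proof -
  define m where "m = \<lceil>log 2 l\<rceil>"
  define s :: real where "s = 2 powi m"
  have s_powr: "s = 2 powr of_int m" by (simp add: s_def powr_real_of_int')
  have s: "s > 0" by (simp add: s_def)
  have l_eq: "l = 2 powr log 2 l" using assms by simp
  have "l \<le> s" unfolding s_powr by (subst l_eq) (simp add: m_def)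
  moreover have "s \<le> 2 * l"
  proof -
    have "s \<le> 2 powr (1 + log 2 l)"
      unfolding s_powr m_def by (intro powr_mono) (linarith, simp)
    also have "\<dots> = 2 * l" using assms by (simp add: powr_add)
    finally show ?thesis .
  qed
  \<comment> \<open>the two dyadic intervals in direction \<open>i\<close> start with the one containing \<open>a $ i\<close>\<close>
  moreover define k where "k i = - 1 - \<lfloor>a $ i / s\<rfloor>" for i
  have "cbox a (\<chi> i. a $ i + l) \<subseteq> dyadic_double_cube m k"
  proof
    fix x assume x: "x \<in> cbox a (\<chi> i. a $ i + l)"
    have "s * of_int \<lfloor>a $ i / s\<rfloor> \<le> x $ i \<and> x $ i \<le> s * of_int \<lfloor>a $ i / s\<rfloor> + s * 2" for i
    proof -
      have "a $ i \<le> x $ i" "x $ i \<le> a $ i + l" using x by (simp_all add: mem_box_cart)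
      moreover have "s * of_int \<lfloor>a $ i / s\<rfloor> \<le> s * (a $ i / s)" "s * (a $ i / s) \<le> s * (of_int \<lfloor>a $ i / s\<rfloor> + 1)"
        using s by (intro mult_left_mono; linarith)+
      ultimately show ?thesis using s \<open>l \<le> s\<close> by (simp add: algebra_simps)
    qed
    then show "x \<in> dyadic_double_cube m k"
      by (simp add: mem_box_cart dyadic_shift_def k_def s_def[symmetric] algebra_simps)
  qed
  ultimately show ?thesis using that unfolding s_def by blast
qed

section \<open>Comparison of the two seminorms\<close>

context
  fixes \<alpha> :: real and M :: nat and p :: "nat \<Rightarrow> real ^ 'n::finite \<Rightarrow> real" and g :: "real ^ 'n \<Rightarrow> real"
  assumes alpha: "\<alpha> \<ge> 0" and basis: "orthonormal_basis_A \<alpha> M p"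
    and g: "locally_square_integrable g"
begin

lemma lip_norm_dyadic_le: "lip_norm \<alpha> dyadic_cubes g \<le> lip_norm \<alpha> cubes g"
  unfolding lip_norm_cubes[OF g] lip_norm_dyadic
  by (rule SUP_subset_mono[OF dyadic_cubes_subset_cubes]) simp

text \<open>The functions of the family are orthogonal to polynomials, so pairing with \<open>g\<close> is pairing with
  \<open>g\<close> minus its approximating polynomial on the supporting cube.\<close>

lemma A_functional_le:
  "A_functional \<alpha> M p g \<le> ennreal (2 powr \<alpha> * sqrt (2 ^ CARD('n))) * lip_norm \<alpha> cubes g"
  unfolding A_functional_def
proof (rule SUP_least)
  fix h assume "h \<in> S_family \<alpha> M p"
  then obtain n and k :: "'n \<Rightarrow> int" and L where L: "L \<in> {1..M}"
    and h: "h = (\<lambda>x. 2 powr (of_int n * (real CARD('n) + \<alpha>)) * p L (\<chi> i. 2 powi n * x $ i + of_int (k i)))"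
    unfolding S_family_def by blast
  let ?s = "2 powi (- n) :: real" and ?G = "dyadic_rescale (- n) k g" and ?R = "dyadic_double_cube (- n) k"
  have G: "L2_Q0 ?G" by (intro L2_Q0_affine g) simp
  have "\<bar>pairing g h\<bar> = ?s powr (- \<alpha>) * \<bar>pairing ?G (p L)\<bar>"
    unfolding h pairing_S_family[OF g basis_borel_measurable[OF basis L]] by (simp add: abs_mult)
  also have "\<dots> \<le> ?s powr (- \<alpha>) * sqrt (poly_error \<alpha> Q0 ?G)"
    using pairing_basis_square_le[OF basis G L]
    by (intro mult_left_mono real_le_rsqrt) simp_all
  also have "\<dots> = 2 powr \<alpha> * sqrt (2 ^ CARD('n)) * oscillation \<alpha> ?R g"
    unfolding oscillation_dyadic_double_cube[OF g] by (simp add: powr_minus real_sqrt_divide)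
  finally have "ennreal \<bar>pairing g h\<bar> \<le> ennreal (2 powr \<alpha> * sqrt (2 ^ CARD('n)) * oscillation \<alpha> ?R g)"
    by (rule ennreal_leI)
  also have "\<dots> = ennreal (2 powr \<alpha> * sqrt (2 ^ CARD('n))) * ennreal (oscillation \<alpha> ?R g)"
    by (rule ennreal_mult') simp
  also have "\<dots> \<le> ennreal (2 powr \<alpha> * sqrt (2 ^ CARD('n))) * lip_norm \<alpha> cubes g"
    unfolding lip_norm_cubes[OF g]
    by (intro mult_left_mono SUP_upper cubesI[of "?s * 2", OF _ refl]) simp_all
  finally show "ennreal \<bar>pairing g h\<bar> \<le> ennreal (2 powr \<alpha> * sqrt (2 ^ CARD('n))) * lip_norm \<alpha> cubes g" .
qed

context
  fixes D A :: real
  assumes D: "\<And>Q. Q \<in> dyadic_cubes \<Longrightarrow> oscillation \<alpha> Q g \<le> D"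
    and A: "\<And>h. h \<in> S_family \<alpha> M p \<Longrightarrow> \<bar>pairing g h\<bar> \<le> A"
    and D_nonneg: "D \<ge> 0" and A_nonneg: "A \<ge> 0"
begin

text \<open>Rescaling turns the subcubes of \<open>[-1,1]\<^sup>N\<close> into dyadic cubes and the basis functions into
  members of the family, so both terms bounding the error on \<open>[-1,1]\<^sup>N\<close> are controlled.\<close>

lemma sqrt_poly_error_Q0_rescaled_le:
  defines "K \<equiv> 2 * real (card (Q0_subcubes :: (real ^ 'n) set set)) + 2 * real M"
  shows "(2 powi m) powr (- \<alpha>) * sqrt (poly_error \<alpha> Q0 (dyadic_rescale m k g)) \<le> sqrt K * (D + A)"
proof -
  let ?s = "2 powi m :: real" and ?G = "dyadic_rescale m k g"
  let ?w = "?s powr (- \<alpha>)"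
  have G: "L2_Q0 ?G" by (intro L2_Q0_affine g) simp
  have sub: "?w\<^sup>2 * poly_error \<alpha> J ?G \<le> D\<^sup>2" if J: "J \<in> Q0_subcubes" for J
  proof -
    obtain a where a: "\<forall>i. a $ i \<in> {-1, 0}" "J = cbox a (\<chi> i. a $ i + 1)"
      using J by (rule Q0_subcubesE)
    have "?w * sqrt (poly_error \<alpha> J ?G) =
        oscillation \<alpha> (cbox (dyadic_shift m k + ?s *\<^sub>R a) (\<chi> i. (dyadic_shift m k + ?s *\<^sub>R a) $ i + ?s)) g"
      using oscillation_affine[OF g, of ?s 1 \<alpha> "dyadic_shift m k" a] by (simp add: oscillation_cube a(2))
    also have "\<dots> \<le> D"
      by (rule D[OF dyadic_rescale_subcube_in_dyadic_cubes[OF a(1)]])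
    finally have "(?w * sqrt (poly_error \<alpha> J ?G))\<^sup>2 \<le> D\<^sup>2"
      by (rule power_mono) (simp add: poly_error_nonneg)
    then show ?thesis by (simp add: power_mult_distrib poly_error_nonneg)
  qed
  have coeff: "?w\<^sup>2 * (pairing ?G (p L))\<^sup>2 \<le> A\<^sup>2" if L: "L \<in> {1..M}" for L
  proof -
    let ?h = "\<lambda>x. 2 powr (of_int (- m) * (real CARD('n) + \<alpha>)) * p L (\<chi> i. 2 powi (- m) * x $ i + of_int (k i))"
    have "?h \<in> S_family \<alpha> M p" unfolding S_family_def using L by blast
    then have "\<bar>?w * pairing ?G (p L)\<bar> \<le> A"
      using A[of ?h] pairing_S_family[OF g basis_borel_measurable[OF basis L], of "- m" \<alpha> k] by simp
    then have "(?w * pairing ?G (p L))\<^sup>2 \<le> A\<^sup>2"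
      by (rule power2_le_iff_abs_le[THEN iffD2, OF A_nonneg])
    then show ?thesis by (simp add: power_mult_distrib)
  qed
  have "(?w * sqrt (poly_error \<alpha> Q0 ?G))\<^sup>2 = ?w\<^sup>2 * poly_error \<alpha> Q0 ?G"
    by (simp add: power_mult_distrib poly_error_nonneg)
  also have "\<dots> \<le> ?w\<^sup>2 * (2 * (\<Sum>J\<in>Q0_subcubes. poly_error \<alpha> J ?G) + 2 * (\<Sum>L\<in>{1..M}. (pairing ?G (p L))\<^sup>2))"
    by (intro mult_left_mono poly_error_Q0_le[OF basis G]) simp
  also have "\<dots> = 2 * (\<Sum>J\<in>Q0_subcubes. ?w\<^sup>2 * poly_error \<alpha> J ?G) + 2 * (\<Sum>L\<in>{1..M}. ?w\<^sup>2 * (pairing ?G (p L))\<^sup>2)"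
    by (simp add: sum_distrib_left algebra_simps)
  also have "\<dots> \<le> 2 * (\<Sum>J\<in>(Q0_subcubes :: (real ^ 'n) set set). D\<^sup>2) + 2 * (\<Sum>L\<in>{1..M}. A\<^sup>2)"
    by (intro add_mono mult_left_mono sum_mono sub coeff) simp_all
  also have "\<dots> = 2 * real (card (Q0_subcubes :: (real ^ 'n) set set)) * D\<^sup>2 + 2 * real M * A\<^sup>2"
    by simp
  also have "\<dots> \<le> 2 * real (card (Q0_subcubes :: (real ^ 'n) set set)) * (D + A)\<^sup>2 + 2 * real M * (D + A)\<^sup>2"
    using D_nonneg A_nonneg by (intro add_mono mult_left_mono power_mono) simp_all
  also have "\<dots> = K * (D + A)\<^sup>2" by (simp add: K_def algebra_simps)
  finally have "?w * sqrt (poly_error \<alpha> Q0 ?G) \<le> sqrt (K * (D + A)\<^sup>2)"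
    by (rule real_le_rsqrt)
  then show ?thesis using D_nonneg A_nonneg by (simp add: real_sqrt_mult)
qed

text \<open>The containing double cube has at most four times the side, so by monotonicity of the error
  passing to it costs only a factor depending on \<open>\<alpha>\<close> and \<open>N\<close>.\<close>

lemma oscillation_le:
  assumes "Q \<in> cubes"
  shows "oscillation \<alpha> Q g \<le> 2 powr \<alpha> * sqrt (2 ^ CARD('n)) *
    sqrt (2 * real (card (Q0_subcubes :: (real ^ 'n) set set)) + 2 * real M) * (D + A)"
proof -
  obtain a l where l: "l > 0" and Q: "Q = cbox a (\<chi> i. a $ i + l)"
    using assms by (rule cubesE)
  obtain m k where m: "l \<le> 2 powi m" "2 powi m \<le> 2 * l" and sub: "Q \<subseteq> dyadic_double_cube m k"
    using cube_subset_dyadic_double_cube[OF l, of a] unfolding Q by metis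
  let ?s = "2 powi m :: real" and ?G = "dyadic_rescale m k g" and ?R = "dyadic_double_cube m k"
  let ?E = "poly_error \<alpha> Q0 ?G"
  have s: "?s > 0" by simp
  have corner: "dyadic_shift m k + ?s *\<^sub>R (\<chi> i. 1) =
      (\<chi> i. (dyadic_shift m k + ?s *\<^sub>R (\<chi> i. -1)) $ i + ?s * 2)"
    by (simp add: vec_eq_iff)
  have error_R: "poly_error \<alpha> ?R g = ?s ^ CARD('n) * ?E"
    unfolding Q0_def corner[symmetric]
    by (intro poly_error_affine s locally_square_integrable_on_cbox g)
      (use box_cube_nonempty[of 2 "(\<chi> i. -1) :: real ^ 'n"] in simp)
  have "poly_error \<alpha> Q g \<le> poly_error \<alpha> ?R g"
    using sub unfolding Q
    by (intro poly_error_mono locally_square_integrable_on_cbox g box_cube_nonempty l)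
  then have "poly_error \<alpha> Q g / l ^ CARD('n) \<le> ?s ^ CARD('n) * ?E / (?s / 2) ^ CARD('n)"
    unfolding error_R using m l s
    by (intro frac_le power_mono mult_nonneg_nonneg poly_error_nonneg) auto
  also have "\<dots> = 2 ^ CARD('n) * ?E" using s by (simp add: power_divide)
  finally have "sqrt (poly_error \<alpha> Q g / l ^ CARD('n)) \<le> sqrt (2 ^ CARD('n) * ?E)"
    by (rule real_sqrt_le_mono)
  moreover have "l powr (- \<alpha>) \<le> (?s / 2) powr (- \<alpha>)"
    using m l s alpha by (intro powr_mono2') auto
  ultimately have "oscillation \<alpha> Q g \<le> (?s / 2) powr (- \<alpha>) * sqrt (2 ^ CARD('n) * ?E)"
    unfolding Q oscillation_cube[OF l] by (intro mult_mono) (auto simp: poly_error_nonneg l less_imp_le)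
  also have "\<dots> = 2 powr \<alpha> * sqrt (2 ^ CARD('n)) * (?s powr (- \<alpha>) * sqrt ?E)"
    using s by (simp add: powr_divide powr_minus real_sqrt_mult field_simps)
  also have "\<dots> \<le> 2 powr \<alpha> * sqrt (2 ^ CARD('n)) *
      (sqrt (2 * real (card (Q0_subcubes :: (real ^ 'n) set set)) + 2 * real M) * (D + A))"
    by (intro mult_left_mono sqrt_poly_error_Q0_rescaled_le) simp
  finally show ?thesis by (simp add: mult.assoc)
qed

end

lemma lip_norm_cubes_le:
  assumes C: "C > 0" "2 powr \<alpha> * sqrt (2 ^ CARD('n)) *
    sqrt (2 * real (card (Q0_subcubes :: (real ^ 'n) set set)) + 2 * real M) \<le> C"
  shows "lip_norm \<alpha> cubes g \<le> ennreal C * (lip_norm \<alpha> dyadic_cubes g + A_functional \<alpha> M p g)"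
proof (cases "lip_norm \<alpha> dyadic_cubes g + A_functional \<alpha> M p g = top")
  case True
  show ?thesis unfolding True using C(1) by (simp add: ennreal_mult_top)
next
  case False
  define D where "D = enn2real (lip_norm \<alpha> dyadic_cubes g)"
  define A where "A = enn2real (A_functional \<alpha> M p g)"
  have D: "lip_norm \<alpha> dyadic_cubes g = ennreal D" and A: "A_functional \<alpha> M p g = ennreal A"
    using False by (auto simp: D_def A_def less_top)
  have nonneg: "D \<ge> 0" "A \<ge> 0" by (simp_all add: D_def A_def)
  have D': "oscillation \<alpha> Q g \<le> D" if "Q \<in> dyadic_cubes" for Q
  proof -
    have "ennreal (oscillation \<alpha> Q g) \<le> ennreal D"
      unfolding D[symmetric] lip_norm_dyadic using that by (rule SUP_upper)
    then show ?thesis using nonneg by (simp add: ennreal_le_iff)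
  qed
  have A': "\<bar>pairing g h\<bar> \<le> A" if "h \<in> S_family \<alpha> M p" for h
  proof -
    have "ennreal \<bar>pairing g h\<bar> \<le> ennreal A"
      unfolding A[symmetric] A_functional_def using that by (rule SUP_upper)
    then show ?thesis using nonneg by (simp add: ennreal_le_iff)
  qed
  have "oscillation \<alpha> Q g \<le> C * (D + A)" if "Q \<in> cubes" for Q
    using oscillation_le[OF D' A' nonneg that] mult_right_mono[OF C(2), of "D + A"] nonneg by linarith
  then have "lip_norm \<alpha> cubes g \<le> ennreal (C * (D + A))"
    unfolding lip_norm_cubes[OF g] by (intro SUP_least ennreal_leI)
  also have "\<dots> = ennreal C * (ennreal D + ennreal A)"
    using nonneg C(1) by (simp add: ennreal_mult' ennreal_plus)
  finally show ?thesis by (simp add: D A)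
qed

end

theorem theoremA:
  fixes \<alpha> :: real and M :: nat and p :: "nat \<Rightarrow> real ^ 'n::finite \<Rightarrow> real"
  assumes "\<alpha> \<ge> 0"
    and "orthonormal_basis_A \<alpha> M p"
  shows "(\<forall>g :: real ^ 'n \<Rightarrow> real. locally_square_integrable g \<longrightarrow>
            (g \<in> lip_space \<alpha> cubes \<longleftrightarrow>
             g \<in> lip_space \<alpha> dyadic_cubes \<and> A_functional \<alpha> M p g < \<infinity>)) \<and>
         (\<exists>c::real. c > 0 \<and> (\<forall>g :: real ^ 'n \<Rightarrow> real. locally_square_integrable g \<longrightarrow>
            ennreal (inverse c) * lip_norm \<alpha> cubes g
              \<le> lip_norm \<alpha> dyadic_cubes g + A_functional \<alpha> M p g \<and>
            lip_norm \<alpha> dyadic_cubes g + A_functional \<alpha> M p g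
              \<le> ennreal c * lip_norm \<alpha> cubes g))"
proof -
  \<comment> \<open>\<open>C1\<close> comes from comparing an arbitrary cube with a double cube, and \<open>C2\<close> also
    counts the terms in the bound for the error on \<open>[-1,1]\<^sup>N\<close>\<close>
  define C1 where "C1 = 2 powr \<alpha> * sqrt (2 ^ CARD('n))"
  define C2 where "C2 = C1 * sqrt (2 * real (card (Q0_subcubes :: (real ^ 'n) set set)) + 2 * real M)"
  \<comment> \<open>the summand \<open>1\<close> accounts for the dyadic seminorm in the upper bound\<close>
  define c where "c = 1 + C1 + C2"
  have C: "C1 \<ge> 0" "C2 \<ge> 0" by (simp_all add: C1_def C2_def)
  then have c: "c > 0" by (simp add: c_def)
  have upper: "lip_norm \<alpha> dyadic_cubes g + A_functional \<alpha> M p g \<le> ennreal c * lip_norm \<alpha> cubes g"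
    if g: "locally_square_integrable g" for g :: "real ^ 'n \<Rightarrow> real"
  proof -
    have "lip_norm \<alpha> dyadic_cubes g + A_functional \<alpha> M p g \<le>
        lip_norm \<alpha> cubes g + ennreal C1 * lip_norm \<alpha> cubes g"
      unfolding C1_def by (intro add_mono lip_norm_dyadic_le[OF assms g] A_functional_le[OF assms g])
    also have "\<dots> = ennreal (1 + C1) * lip_norm \<alpha> cubes g"
      using C by (simp add: ennreal_plus distrib_right)
    also have "\<dots> \<le> ennreal c * lip_norm \<alpha> cubes g"
      using C by (intro mult_right_mono ennreal_leI) (simp_all add: c_def)
    finally show ?thesis .
  qed
  have lower: "lip_norm \<alpha> cubes g \<le> ennreal c * (lip_norm \<alpha> dyadic_cubes g + A_functional \<alpha> M p g)"
    if g: "locally_square_integrable g" for g :: "real ^ 'n \<Rightarrow> real"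
    by (rule lip_norm_cubes_le[OF assms g c]) (use C in \<open>simp add: c_def C2_def C1_def\<close>)
  have lower': "ennreal (inverse c) * lip_norm \<alpha> cubes g \<le> lip_norm \<alpha> dyadic_cubes g + A_functional \<alpha> M p g"
    if g: "locally_square_integrable g" for g :: "real ^ 'n \<Rightarrow> real"
  proof -
    have "ennreal (inverse c) * lip_norm \<alpha> cubes g \<le>
        ennreal (inverse c) * (ennreal c * (lip_norm \<alpha> dyadic_cubes g + A_functional \<alpha> M p g))"
      by (intro mult_left_mono lower g) simp
    also have "\<dots> = lip_norm \<alpha> dyadic_cubes g + A_functional \<alpha> M p g"
      using c by (simp add: mult.assoc[symmetric] ennreal_mult'[symmetric])
    finally show ?thesis .
  qed
  have "g \<in> lip_space \<alpha> cubes \<longleftrightarrow> g \<in> lip_space \<alpha> dyadic_cubes \<and> A_functional \<alpha> M p g < \<infinity>"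
    if g: "locally_square_integrable g" for g :: "real ^ 'n \<Rightarrow> real"
  proof -
    have "lip_norm \<alpha> cubes g < \<infinity> \<longleftrightarrow> lip_norm \<alpha> dyadic_cubes g + A_functional \<alpha> M p g < \<infinity>"
      using upper[OF g] lower[OF g]
      by (metis ennreal_mult_less_top ennreal_less_top infinity_ennreal_def order.strict_trans1)
    then show ?thesis
      using g borel_measurable_sharp_max_cubes[OF g] borel_measurable_sharp_max_dyadic[of \<alpha> g]
      by (auto simp: lip_space_def)
  qed
  then show ?thesis using c upper lower' by blast
qed

end
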